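(* In the AR($p$) observation model described in the context, let $\hat{\mathbf a}^{b}_p=[\hat a^{b}_1,\ldots,\hat a^{b}_p]^{\mathsf T}$ and $\hat{\mathbf a}^{u}_p=[\hat a^{u}_1,\ldots,\hat a^{u}_p]^{\mathsf T}$ be the biased and unbiased estimators of the AR coefficients, defined for $\bullet\in\{b,u\}$ by $$\hat{\mathbf a}^{\bullet}_p=\left(\widehat{\mathbf R}^{\bullet}_p\right)^{-1}\hat{\mathbf r}^{\bullet}_p,\qquad \hat{\mathbf r}^{\bullet}_p=[\hat r^{\bullet}(1),\ldots,\hat r^{\bullet}(p)]^{\mathsf T},\qquad \widehat{\mathbf R}^{\bullet}_p=\mathcal T\left(\hat r^{\bullet}(1-p),\ldots,\hat r^{\bullet}(p-1)\right).$$ Then, as $T\to\infty$ with $N_r=N_r(T)$ and $N_r/T\to c\in(0,\infty)$, for all $i=1,\ldots,p$, $$\hat a^{b}_i\to a_i\quad\text{and}\quad \hat a^{u}_i\to a_i\qquad\text{almost surely.}$$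
   Context: Model. Fix an order $p\ge 1$, real coefficients $a_1,\ldots,a_p$, and known variances $\sigma_x^2>0$ and $\sigma_w^2\geq 0$, none of which depend on $N_r$ or $T$. For $n=0,\ldots,N_r-1$, the processes $(h_n(t))_{t\in\mathbb Z}$ are independent and identically distributed in $n$. Each is a zero-mean stationary circular complex Gaussian process satisfying the (causal) AR($p$) equation $$h_n(t)=a_1h_n(t-1)+\cdots+a_ph_n(t-p)+x_n(t),$$ where the $x_n(t)\sim\mathcal{CN}(0,\sigma_x^2)$ are i.i.d. in $n$ and $t$ and $x_n(t)$ is independent of the past $(h_n(s))_{s<t}$. The observations are $$\hat h_n(t)=h_n(t)+w_n(t),\qquad 0\le n\le N_r-1,\ 0\le t\le T-1,$$ where the $w_n(t)\sim\mathcal{CN}(0,\sigma_w^2)$ are i.i.d. and independent of all $h_n$. Here $\mathcal{CN}(0,\sigma^2)$ is the circular complex Gaussian law with mean $0$ and variance $\sigma^2$. All random variables, for all values of $T$ and $N_r=N_r(T)$, live on a common probability space. Covariances. $r(k)=\sigma_x^{-2}\,\mathbb E[h_n(t)h_n(t-k)^*]$ (so $r(k)$ is real and even). It is assumed that $\sum_{k=1-T}^{T-1}|r(k)|\le K$ with $K$ a fixed constant independent of $T,N_r$. For a finite sequence $c(1-m),\ldots,c(m-1)$, $\mathcal T(c(1-m),\ldots,c(m-1))$ denotes the $m\times m$ Toeplitz matrix with $(i,j)$ entry $c(i-j)$. With $\mathbf R_p=\mathcal T(r(1-p),\ldots,r(p-1))$, which is invertible, and $\mathbf r_p=[r(1),\ldots,r(p)]^{\mathsf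 T}$, the Yule-Walker equations give $[a_1,\ldots,a_p]^{\mathsf T}=\mathbf R_p^{-1}\mathbf r_p$. Estimates. $$\hat r^{b}(0)=\hat r^{u}(0)=\frac{1}{\sigma_x^2N_rT}\sum_{n=0}^{N_r-1}\sum_{t=0}^{T-1}|\hat h_n(t)|^2-\frac{\sigma_w^2}{\sigma_x^2},$$ and for $1\le|k|\le T-1$, $$\hat r^{b}(k)=\frac{1}{\sigma_x^2N_rT}\sum_{n=0}^{N_r-1}\sum_{t}\hat h_n(t+k)\hat h_n(t)^*,\qquad \hat r^{u}(k)=\frac{1}{\sigma_x^2N_r(T-|k|)}\sum_{n=0}^{N_r-1}\sum_{t}\hat h_n(t+k)\hat h_n(t)^*,$$ where the sums over $t$ run over $0\le t\le T-1$ with $0\le t+k\le T-1$. *)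

theory Defs
  imports
    "HOL-Probability.Probability"
    "Jordan_Normal_Form.Gauss_Jordan_Elimination"
begin

text \<open>Univariate normal law with standard deviation \<open>\<sigma>\<close>. The degenerate case is split off because
  \<^const>\<open>normal_density\<close> with zero deviation is the zero function, not a density.\<close>

definition normal_law :: "real \<Rightarrow> real \<Rightarrow> real measure" where
  "normal_law \<mu> \<sigma> =
     (if \<sigma> = 0 then return borel \<mu> else density lborel (normal_density \<mu> \<sigma>))"

text \<open>Circular complex normal law of mean \<open>0\<close> and variance \<open>v\<close>: independent real and imaginary
  parts, each of variance \<open>v / 2\<close>.\<close>

definition complex_normal_law :: "real \<Rightarrow> complex measure" where
  "complex_normal_law v =
     distr (normal_law 0 (sqrt (v / 2)) \<Otimes>\<^sub>M normal_law 0 (sqrt (v / 2))) borel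
       (\<lambda>(a, b). Complex a b)"

text \<open>A complex process is Gaussian if its real and imaginary parts together form a real Gaussian
  process, i.e. all their finite real-linear combinations are (possibly degenerate) normal.\<close>

definition gaussian_process :: "'a measure \<Rightarrow> (int \<Rightarrow> 'a \<Rightarrow> complex) \<Rightarrow> bool" where
  "gaussian_process M z \<longleftrightarrow>
     (\<forall>J u v. finite J \<longrightarrow>
       (\<exists>\<mu> \<sigma>. 0 \<le> \<sigma> \<and>
         distr M borel (\<lambda>\<omega>. \<Sum>t\<in>J. u t * Re (z t \<omega>) + v t * Im (z t \<omega>)) = normal_law \<mu> \<sigma>))"

definition process_law :: "'a measure \<Rightarrow> (int \<Rightarrow> 'a \<Rightarrow> complex) \<Rightarrow> (int \<Rightarrow> complex) measure" where
  "process_law M z = distr M (\<Pi>\<^sub>M t\<in>UNIV. borel) (\<lambda>\<omega> t. z t \<omega>)"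

definition circular_process :: "'a measure \<Rightarrow> (int \<Rightarrow> 'a \<Rightarrow> complex) \<Rightarrow> bool" where
  "circular_process M z \<longleftrightarrow>
     (\<forall>\<theta>. process_law M (\<lambda>t \<omega>. cis \<theta> * z t \<omega>) = process_law M z)"

definition stationary_process :: "'a measure \<Rightarrow> (int \<Rightarrow> 'a \<Rightarrow> complex) \<Rightarrow> bool" where
  "stationary_process M z \<longleftrightarrow>
     (\<forall>s. process_law M (\<lambda>t. z (t + s)) = process_law M z)"

text \<open>The observation model for one fixed pair \<open>(N, T)\<close>; the index \<open>n\<close> of the processes ranges over
  \<open>n < N\<close>. The innovation \<open>x n t\<close> is passed to \<open>indep_var\<close> as a family indexed by the singleton
  \<open>{t}\<close>, because both arguments of \<open>indep_var\<close> must have the same type.\<close>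

locale ar_observation_model = prob_space M
  for M :: "'a measure" +
  fixes p :: nat and a :: "nat \<Rightarrow> real" and \<sigma>\<^sub>x \<sigma>\<^sub>w :: real
    and N T :: nat
    and h x w :: "nat \<Rightarrow> int \<Rightarrow> 'a \<Rightarrow> complex"
  assumes h_measurable: "\<And>n t. n < N \<Longrightarrow> random_variable borel (h n t)"
    and h_indep: "indep_vars (\<lambda>_. \<Pi>\<^sub>M t\<in>UNIV. borel) (\<lambda>n \<omega> t. h n t \<omega>) {..<N}"
    and h_ident: "\<And>m n. m < N \<Longrightarrow> n < N \<Longrightarrow> process_law M (h m) = process_law M (h n)"
    and h_mean: "\<And>n t. n < N \<Longrightarrow> expectation (h n t) = 0"
    and h_stationary: "\<And>n. n < N \<Longrightarrow> stationary_process M (h n)"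
    and h_circular: "\<And>n. n < N \<Longrightarrow> circular_process M (h n)"
    and h_gaussian: "\<And>n. n < N \<Longrightarrow> gaussian_process M (h n)"
    and ar_equation: "\<And>n t. n < N \<Longrightarrow>
          AE \<omega> in M. h n t \<omega> = (\<Sum>i=1..p. of_real (a i) * h n (t - int i) \<omega>) + x n t \<omega>"
    and x_law: "\<And>n t. n < N \<Longrightarrow> distr M borel (x n t) = complex_normal_law (\<sigma>\<^sub>x\<^sup>2)"
    and x_indep: "indep_vars (\<lambda>_. borel) (\<lambda>(n, t). x n t) ({..<N} \<times> UNIV)"
    and x_indep_past: "\<And>n t. n < N \<Longrightarrow>
          indep_var (\<Pi>\<^sub>M s\<in>{t}. borel) (\<lambda>\<omega>. \<lambda>s\<in>{t}. x n s \<omega>)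
                    (\<Pi>\<^sub>M s\<in>{..<t}. borel) (\<lambda>\<omega>. \<lambda>s\<in>{..<t}. h n s \<omega>)"
    and w_law: "\<And>n t. n < N \<Longrightarrow> 0 \<le> t \<Longrightarrow> t < int T \<Longrightarrow>
          distr M borel (w n t) = complex_normal_law (\<sigma>\<^sub>w\<^sup>2)"
    and w_indep: "indep_vars (\<lambda>_. borel) (\<lambda>(n, t). w n t) ({..<N} \<times> {0..<int T})"
    and w_indep_h:
          "indep_var (\<Pi>\<^sub>M q\<in>{..<N} \<times> {0..<int T}. borel)
                     (\<lambda>\<omega>. \<lambda>(n, t)\<in>{..<N} \<times> {0..<int T}. w n t \<omega>)
                     (\<Pi>\<^sub>M q\<in>{..<N} \<times> UNIV. borel)
                     (\<lambda>\<omega>. \<lambda>(n, t)\<in>{..<N} \<times> UNIV. h n t \<omega>)"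

text \<open>In the sample covariances, \<open>g n t\<close> is the observed value of process \<open>n\<close> at time \<open>t\<close>.\<close>

definition lag_product_sum :: "nat \<Rightarrow> nat \<Rightarrow> (nat \<Rightarrow> int \<Rightarrow> complex) \<Rightarrow> int \<Rightarrow> complex" where
  "lag_product_sum N T g k =
     (\<Sum>n<N. \<Sum>t | 0 \<le> t \<and> t \<le> int T - 1 \<and> 0 \<le> t + k \<and> t + k \<le> int T - 1.
        g n (t + k) * cnj (g n t))"

definition sample_cov_zero ::
    "real \<Rightarrow> real \<Rightarrow> nat \<Rightarrow> nat \<Rightarrow> (nat \<Rightarrow> int \<Rightarrow> complex) \<Rightarrow> real" where
  "sample_cov_zero \<sigma>\<^sub>x \<sigma>\<^sub>w N T g =
     1 / (\<sigma>\<^sub>x\<^sup>2 * real N * real T) * (\<Sum>n<N. \<Sum>t=0..int T - 1. (cmod (g n t))\<^sup>2)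
       - \<sigma>\<^sub>w\<^sup>2 / \<sigma>\<^sub>x\<^sup>2"

definition biased_cov ::
    "real \<Rightarrow> real \<Rightarrow> nat \<Rightarrow> nat \<Rightarrow> (nat \<Rightarrow> int \<Rightarrow> complex) \<Rightarrow> int \<Rightarrow> complex" where
  "biased_cov \<sigma>\<^sub>x \<sigma>\<^sub>w N T g k =
     (if k = 0 then of_real (sample_cov_zero \<sigma>\<^sub>x \<sigma>\<^sub>w N T g)
      else of_real (1 / (\<sigma>\<^sub>x\<^sup>2 * real N * real T)) * lag_product_sum N T g k)"

definition unbiased_cov ::
    "real \<Rightarrow> real \<Rightarrow> nat \<Rightarrow> nat \<Rightarrow> (nat \<Rightarrow> int \<Rightarrow> complex) \<Rightarrow> int \<Rightarrow> complex" where
  "unbiased_cov \<sigma>\<^sub>x \<sigma>\<^sub>w N T g k =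
     (if k = 0 then of_real (sample_cov_zero \<sigma>\<^sub>x \<sigma>\<^sub>w N T g)
      else of_real (1 / (\<sigma>\<^sub>x\<^sup>2 * real N * (real T - \<bar>real_of_int k\<bar>))) * lag_product_sum N T g k)"

definition toeplitz :: "nat \<Rightarrow> (int \<Rightarrow> complex) \<Rightarrow> complex Matrix.mat" where
  "toeplitz m c = Matrix.mat m m (\<lambda>(i, j). c (int i - int j))"

text \<open>Component \<open>i\<close> (numbered from \<open>1\<close>) of the solution of the Yule-Walker system built from
  the covariances \<open>c\<close>; unspecified where the Toeplitz matrix is singular.\<close>

definition yule_walker :: "nat \<Rightarrow> (int \<Rightarrow> complex) \<Rightarrow> nat \<Rightarrow> complex" where
  "yule_walker p c i =
     vec_index (the (mat_inverse (toeplitz p c)) *\<^sub>v Matrix.vec p (\<lambda>j. c (int j + 1))) (i - 1)"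

end

theory Submission
  imports Defs "Jordan_Normal_Form.Determinant" "HOL-Real_Asymp.Real_Asymp"
begin

text \<open>For each lag the sample covariance is an average over the \<open>N\<^sub>r\<close> independent
  rows \<open>n\<close> of a lag-product mean whose fourth moment is bounded uniformly in \<open>T\<close>: it is controlled by
  eighth moments of Gaussian variables of fixed variance. The fourth moment of a centred average of
  \<open>N\<close> independent variables is \<open>O(1/N\<^sup>2)\<close>, and \<open>N\<^sub>r \<sim> c T\<close> makes these bounds summable in \<open>T\<close>, so the
  averages converge almost surely.

  The limiting system is solved by \<open>a\<^sub>1, \<dots>, a\<^sub>p\<close> because the innovation is orthogonal to the past.
  It is nonsingular: a kernel vector of the Toeplitz matrix would give a vanishing linear combination
  of \<open>h(0), \<dots>, h(p-1)\<close>, so that some innovation \<open>x(m)\<close> would be a combination of values of \<open>h\<close> before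
  time \<open>m\<close>, hence orthogonal to itself. Cramer's rule makes the solution continuous in the covariances.\<close>

section \<open>Continuity of the Yule-Walker solution\<close>

text \<open>The processes for different \<open>T\<close> share nothing but the probability space, so
  no law of large numbers along one fixed sequence applies. Almost sure convergence has to come from
  summable moment bounds, which see each \<open>T\<close> separately. The exponent four comes from
  this: with \<open>N\<^sub>r\<close> of order \<open>T\<close>, a variance bound O(1/N) sums like
  the harmonic series, whereas O(1/N^2) is summable. The fourth moment of a product of two
  observations costs eighth moments of the observations.

  All averaging takes place across rows. Dependence along time stays inside a row, where convexity
  bounds the moment of the time average by moments at single times. Rows are divided by
  \<open>T\<close> at every lag, so their mean carries the factor (T - |k|)/T. The law of large
  numbers therefore allows means that vary with \<open>T\<close>, and the unbiased estimates are
  deterministic multiples of the biased ones.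

  A row mixes a path of \<open>h\<close> with noise of the same index, so independence of rows is
  assembled from three facts: independence among the paths, among the noise variables, and between
  the two families.\<close>

lemma tendsto_det:
  fixes A :: "'b \<Rightarrow> complex Matrix.mat"
  assumes A: "\<And>T. A T \<in> carrier_mat n n" and B: "B \<in> carrier_mat n n"
    and lim: "\<And>i j. i < n \<Longrightarrow> j < n \<Longrightarrow> ((\<lambda>T. A T $$ (i, j)) \<longlongrightarrow> B $$ (i, j)) F"
  shows "((\<lambda>T. Determinant.det (A T)) \<longlongrightarrow> Determinant.det B) F"
proof -
  have "((\<lambda>T. \<Sum>q | q permutes {0..<n}. signof q * (\<Prod>i = 0..<n. A T $$ (i, q i))) \<longlongrightarrow>
        (\<Sum>q | q permutes {0..<n}. signof q * (\<Prod>i = 0..<n. B $$ (i, q i)))) F"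
    by (intro tendsto_sum tendsto_mult tendsto_const tendsto_prod lim) (auto simp: permutes_in_image)
  then show ?thesis
    by (simp only: det_def'[OF A] det_def'[OF B])
qed

text \<open>Cramer's rule in cofactor form. \<open>mat_inverse\<close> is computed by Gauss-Jordan
  elimination, whose case distinctions hide continuity; the right-hand side is a rational function
  of the entries.\<close>

lemma mat_inverse_mult_vec_index:
  fixes A :: "complex Matrix.mat"
  assumes A: "A \<in> carrier_mat n n" and b: "b \<in> carrier_vec n"
    and det: "Determinant.det A \<noteq> 0" and i: "i < n"
  shows "vec_index (the (mat_inverse A) *\<^sub>v b) i =
    (\<Sum>j = 0..<n. cofactor A j i * vec_index b j) / Determinant.det A"
proof -
  obtain C where C: "mat_inverse A = Some C"
    using mat_inverse(1)[OF A, where b = "()"] det_non_zero_imp_unit[OF A det, where b = "()"]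
    by (cases "mat_inverse A") auto
  then have AC: "C * A = 1\<^sub>m n" and C': "C \<in> carrier_mat n n"
    using mat_inverse(2)[OF A C] by auto
  have adj: "adj_mat A \<in> carrier_mat n n" by (rule adj_mat[OF A])
  \<comment> \<open>Inserting \<open>C * A = 1\<close> and regrouping brings in
    \<open>A * adj_mat A\<close>, which is the determinant times the identity. This identifies
    \<open>C\<close> with the adjugate divided by the determinant.\<close>
  have "adj_mat A = (C * A) * adj_mat A" using AC adj by simp
  also have "\<dots> = C * (A * adj_mat A)" using C' A adj by (intro assoc_mult_mat)
  also have "\<dots> = Determinant.det A \<cdot>\<^sub>m C"
    using adj_mat(2)[OF A] C' by (simp add: mult_smult_distrib[OF C' one_carrier_mat])
  finally have eq: "adj_mat A = Determinant.det A \<cdot>\<^sub>m C" .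
  have cof: "cofactor A j i = Determinant.det A * C $$ (i, j)" if "j < n" for j
  proof -
    have "adj_mat A $$ (i, j) = cofactor A j i" using that i A by (auto simp: adj_mat_def)
    then show ?thesis using eq that i C' by simp
  qed
  have "(\<Sum>j = 0..<n. cofactor A j i * vec_index b j) =
      Determinant.det A * (\<Sum>j = 0..<n. C $$ (i, j) * vec_index b j)"
    by (simp add: cof sum_distrib_left mult.assoc)
  moreover have "vec_index (C *\<^sub>v b) i = (\<Sum>j = 0..<n. C $$ (i, j) * vec_index b j)"
    using C' b i by (simp add: scalar_prod_def)
  ultimately show ?thesis using C det by simp
qed

lemma toeplitz_carrier [simp]: "toeplitz m c \<in> carrier_mat m m"
  by (simp add: toeplitz_def)

lemma toeplitz_index: "i < m \<Longrightarrow> j < m \<Longrightarrow> toeplitz m c $$ (i, j) = c (int i - int j)"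
  by (simp add: toeplitz_def)

lemma tendsto_toeplitz_det:
  assumes "\<And>k. \<bar>k\<bar> < int p \<Longrightarrow> ((\<lambda>T. C T k) \<longlongrightarrow> c k) F"
  shows "((\<lambda>T. Determinant.det (toeplitz p (C T))) \<longlongrightarrow> Determinant.det (toeplitz p c)) F"
  by (rule tendsto_det[where n = p]) (auto simp: toeplitz_index intro!: assms)

lemma tendsto_toeplitz_cofactor:
  assumes lim: "\<And>k. \<bar>k\<bar> < int p \<Longrightarrow> ((\<lambda>T. C T k) \<longlongrightarrow> c k) F" and i: "i < p" "j < p"
  shows "((\<lambda>T. cofactor (toeplitz p (C T)) i j) \<longlongrightarrow> cofactor (toeplitz p c) i j) F"
  unfolding cofactor_def
proof (intro tendsto_mult tendsto_const)
  have dc: "mat_delete (toeplitz p c) i j \<in> carrier_mat (p - 1) (p - 1)" for c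
    by (rule mat_delete_carrier) simp
  \<comment> \<open>\<open>insert_index\<close> skips the deleted row or column, so each entry of
    the minor is again a value of \<open>c\<close> at a difference of two indices below
    \<open>p\<close>, hence at a lag covered by \<open>lim\<close>.\<close>
  have idx: "mat_delete (toeplitz p c) i j $$ (k, l) =
      c (int (insert_index i k) - int (insert_index j l))"
      if "k < p - 1" "l < p - 1" for k l c
  proof -
    have "Suc k < p" "Suc l < p" using that by auto
    then show ?thesis using that i
      by (auto simp: mat_delete_def toeplitz_def insert_index_def)
  qed
  show "((\<lambda>T. Determinant.det (mat_delete (toeplitz p (C T)) i j)) \<longlongrightarrow>
      Determinant.det (mat_delete (toeplitz p c) i j)) F"
    by (rule tendsto_det[OF dc dc]) (auto simp: idx insert_index_def intro!: lim)
qed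

lemma yule_walker_cofactor:
  assumes "Determinant.det (toeplitz p c) \<noteq> 0" "i \<in> {1..p}"
  shows "yule_walker p c i =
    (\<Sum>j = 0..<p. cofactor (toeplitz p c) j (i - 1) * c (int j + 1)) / Determinant.det (toeplitz p c)"
proof -
  have "i - 1 < p" using assms by auto
  then show ?thesis unfolding yule_walker_def
    by (subst mat_inverse_mult_vec_index[where n = p]) (use assms in \<open>auto simp: ac_simps\<close>)
qed

text \<open>Where the determinant vanishes, \<open>yule_walker\<close> is unspecified. A nonzero
  limit determinant keeps the approximating determinants eventually nonzero, and from then on
  Cramer's formula applies. Lag \<open>p\<close> itself enters through the last component of the
  right-hand side.\<close>

lemma tendsto_yule_walker:
  assumes lim: "\<And>k. \<bar>k\<bar> \<le> int p \<Longrightarrow> ((\<lambda>T. C T k) \<longlongrightarrow> c k) F"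
    and det: "Determinant.det (toeplitz p c) \<noteq> 0" and i: "i \<in> {1..p}"
  shows "((\<lambda>T. yule_walker p (C T) i) \<longlongrightarrow> yule_walker p c i) F"
proof -
  have lim': "\<And>k. \<bar>k\<bar> < int p \<Longrightarrow> ((\<lambda>T. C T k) \<longlongrightarrow> c k) F" using lim by auto
  have ev: "eventually (\<lambda>T. Determinant.det (toeplitz p (C T)) \<noteq> 0) F"
    using tendsto_imp_eventually_ne[OF tendsto_toeplitz_det[where C = C, OF lim'] det] .
  have "i - 1 < p" using i by auto
  then have "((\<lambda>T. (\<Sum>j = 0..<p. cofactor (toeplitz p (C T)) j (i - 1) * C T (int j + 1)) /
      Determinant.det (toeplitz p (C T))) \<longlongrightarrow> yule_walker p c i) F"
    unfolding yule_walker_cofactor[OF det i]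
    by (intro tendsto_divide tendsto_sum tendsto_mult tendsto_toeplitz_cofactor
        tendsto_toeplitz_det lim lim' det) auto
  then show ?thesis
    by (rule Lim_transform_eventually)
       (use ev in eventually_elim, use yule_walker_cofactor i in auto)
qed

text \<open>The scalar Yule-Walker equations are the rows of one Toeplitz system, and a nonsingular
  system has only one solution.\<close>

lemma yule_walker_eqI:
  assumes det: "Determinant.det (toeplitz p c) \<noteq> 0"
    and eq: "\<And>k. k \<in> {1..p} \<Longrightarrow> c (int k) = (\<Sum>j = 1..p. \<alpha> j * c (int k - int j))"
    and i: "i \<in> {1..p}"
  shows "yule_walker p c i = \<alpha> i"
proof -
  let ?A = "toeplitz p c"
  define v where "v = Matrix.vec p (\<lambda>j. \<alpha> (Suc j))"
  have v: "v \<in> carrier_vec p" by (simp add: v_def)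
  have A: "?A \<in> carrier_mat p p" by simp
  have Av: "?A *\<^sub>v v = Matrix.vec p (\<lambda>j. c (int j + 1))"
  proof (rule eq_vecI)
    fix k assume "k < dim_vec (Matrix.vec p (\<lambda>j. c (int j + 1)))"
    then have k: "k < p" by simp
    have "vec_index (?A *\<^sub>v v) k = (\<Sum>j = 0..<p. c (int k - int j) * \<alpha> (Suc j))"
      using k by (simp add: toeplitz_def scalar_prod_def v_def)
    \<comment> \<open>Rows and unknowns are numbered from 0 in the matrix and from 1 in the
      equations; the two shifts cancel in the lag.\<close>
    also have "\<dots> = (\<Sum>j = 1..p. \<alpha> j * c (int (Suc k) - int j))"
      by (rule sum.reindex_bij_witness[where i = "\<lambda>j. j - 1" and j = Suc])
         (auto simp: algebra_simps of_nat_diff)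
    also have "\<dots> = c (int (Suc k))" using eq[of "Suc k"] k by simp
    finally show "vec_index (?A *\<^sub>v v) k = vec_index (Matrix.vec p (\<lambda>j. c (int j + 1))) k"
      using k by (simp add: add.commute)
  qed (simp add: toeplitz_def)
  obtain C where C: "mat_inverse ?A = Some C"
    using mat_inverse(1)[OF A, where b = "()"] det_non_zero_imp_unit[OF A det, where b = "()"]
    by (cases "mat_inverse ?A") auto
  then have CA: "C * ?A = 1\<^sub>m p" and C': "C \<in> carrier_mat p p"
    using mat_inverse(2)[OF A C] by auto
  have "C *\<^sub>v (?A *\<^sub>v v) = v"
    using assoc_mult_mat_vec[OF C' A v] CA v by simp
  then have "yule_walker p c i = vec_index v (i - 1)" unfolding yule_walker_def using C Av by simp
  also have "\<dots> = \<alpha> i"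
  proof -
    have "i - 1 < p" "Suc (i - 1) = i" using i by auto
    then show ?thesis by (simp only: v_def index_vec)
  qed
  finally show ?thesis .
qed

section \<open>Gaussian moments\<close>

lemma integrable_return:
  fixes f :: "real \<Rightarrow> real"
  assumes "f \<in> borel_measurable borel"
  shows "integrable (return borel x) f"
  using assms by (simp add: integrable_iff_bounded nn_integral_return)

lemma prob_space_normal_law: "0 \<le> \<sigma> \<Longrightarrow> prob_space (normal_law \<mu> \<sigma>)"
  by (auto simp: normal_law_def intro!: prob_space_return prob_space_normal_density)

lemma sets_normal_law [measurable_cong, simp]: "sets (normal_law \<mu> \<sigma>) = sets borel"
  by (simp add: normal_law_def)

text \<open>The constant (2k)!/(2^k k!) is the double factorial (2k-1)!!. At
  \<open>\<sigma> = 0\<close> the law is a point mass and both sides equal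
  \<open>0 ^ (2 * k)\<close>, which is 1 for \<open>k = 0\<close>.\<close>

lemma normal_law_even_moment:
  assumes "0 \<le> \<sigma>"
  shows "has_bochner_integral (normal_law \<mu> \<sigma>) (\<lambda>x. (x - \<mu>) ^ (2 * k))
    (fact (2 * k) / (2 ^ k * fact k) * \<sigma> ^ (2 * k))"
proof (cases "\<sigma> = 0")
  case True
  have "integrable (return borel \<mu>) (\<lambda>x. (x - \<mu>) ^ (2 * k))"
    by (rule integrable_return) simp
  moreover have "integral\<^sup>L (return borel \<mu>) (\<lambda>x. (x - \<mu>) ^ (2 * k)) =
      fact (2 * k) / (2 ^ k * fact k) * \<sigma> ^ (2 * k)"
    using True by (subst integral_return) (auto simp: power_0_left)
  ultimately show ?thesis using True by (simp add: normal_law_def has_bochner_integral_iff)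
next
  case False
  then have "0 < \<sigma>" using assms by simp
  from normal_moment_even[OF this, of \<mu> k]
  show ?thesis using False
    by (simp add: normal_law_def has_bochner_integral_density power_divide mult_ac flip: power_mult)
qed

lemma normal_law_mean:
  assumes "0 \<le> \<sigma>"
  shows "has_bochner_integral (normal_law \<mu> \<sigma>) (\<lambda>x. x) \<mu>"
proof (cases "\<sigma> = 0")
  case True
  then show ?thesis
    by (simp add: normal_law_def has_bochner_integral_iff integrable_return[of "\<lambda>x. x"] integral_return)
next
  case False
  then have "0 < \<sigma>" using assms by simp
  from normal_moment_nz_1[OF this, of \<mu>]
  show ?thesis using False by (simp add: normal_law_def has_bochner_integral_density)
qed

context prob_space
begin

lemma normal_rv_mean:
  assumes "random_variable borel X" "distr M borel X = normal_law \<mu> \<sigma>" "0 \<le> \<sigma>"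
  shows "integrable M X" "expectation X = \<mu>"
  using normal_law_mean[OF assms(3), of \<mu>, folded assms(2)] assms(1)
  by (auto simp: has_bochner_integral_iff integrable_distr_eq integral_distr)

lemma normal_rv_even_moment:
  assumes "random_variable borel X" "distr M borel X = normal_law \<mu> \<sigma>" "0 \<le> \<sigma>"
  shows "integrable M (\<lambda>\<omega>. (X \<omega> - \<mu>) ^ (2 * k))"
    "expectation (\<lambda>\<omega>. (X \<omega> - \<mu>) ^ (2 * k)) = fact (2 * k) / (2 ^ k * fact k) * \<sigma> ^ (2 * k)"
  using normal_law_even_moment[OF assms(3), of \<mu> k, folded assms(2)] assms(1)
  by (auto simp: has_bochner_integral_iff integrable_distr_eq integral_distr)

end

lemma complex_normal_law_Re_Im:
  assumes Z: "Z \<in> borel_measurable M" "distr M borel Z = complex_normal_law v" and v: "0 \<le> v"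
  shows "distr M borel (\<lambda>\<omega>. Re (Z \<omega>)) = normal_law 0 (sqrt (v / 2))"
    and "distr M borel (\<lambda>\<omega>. Im (Z \<omega>)) = normal_law 0 (sqrt (v / 2))"
proof -
  let ?L = "normal_law 0 (sqrt (v / 2))"
  interpret L: prob_space ?L using v by (intro prob_space_normal_law) simp
  interpret P: pair_prob_space ?L ?L ..
  have mC: "(\<lambda>(a, b). Complex a b) \<in> borel_measurable (?L \<Otimes>\<^sub>M ?L)"
    unfolding Complex_eq split_beta by measurable
  have "distr M borel (\<lambda>\<omega>. Re (Z \<omega>)) = distr (distr M borel Z) borel Re"
    using Z(1) by (subst distr_distr) (auto simp: o_def)
  also have "\<dots> = distr (?L \<Otimes>\<^sub>M ?L) borel fst"
    unfolding Z(2) complex_normal_law_def using mC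
    by (subst distr_distr) (auto simp: o_def split_beta)
  also have "\<dots> = distr (?L \<Otimes>\<^sub>M ?L) ?L fst" by (rule distr_cong) auto
  also have "\<dots> = ?L" by (rule L.distr_pair_fst)
  finally show "distr M borel (\<lambda>\<omega>. Re (Z \<omega>)) = ?L" .
  have "distr M borel (\<lambda>\<omega>. Im (Z \<omega>)) = distr (distr M borel Z) borel Im"
    using Z(1) by (subst distr_distr) (auto simp: o_def)
  also have "\<dots> = distr (?L \<Otimes>\<^sub>M ?L) borel snd"
    unfolding Z(2) complex_normal_law_def using mC
    by (subst distr_distr) (auto simp: o_def split_beta)
  also have "\<dots> = distr (?L \<Otimes>\<^sub>M ?L) ?L snd" by (rule distr_cong) auto
  also have "\<dots> = ?L" 
  proof -
    \<comment> \<open>The two factors are the same measure, so exchanging them reduces the second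
      marginal to the first.\<close>
    have "distr (?L \<Otimes>\<^sub>M ?L) ?L snd = distr (distr (?L \<Otimes>\<^sub>M ?L) (?L \<Otimes>\<^sub>M ?L) (\<lambda>(x, y). (y, x))) ?L fst"
      by (subst distr_distr) (auto simp: o_def split_beta)
    also have "\<dots> = distr (?L \<Otimes>\<^sub>M ?L) ?L fst" by (subst P.distr_pair_swap[symmetric]) simp
    finally show ?thesis by (simp add: L.distr_pair_fst)
  qed
  finally show "distr M borel (\<lambda>\<omega>. Im (Z \<omega>)) = ?L" .
qed

lemma borel_measurable_cnj [measurable (raw)]:
  assumes "f \<in> borel_measurable M"
  shows "(\<lambda>x. cnj (f x)) \<in> borel_measurable M"
  by (rule measurable_compose[OF assms])
     (auto intro!: borel_measurable_continuous_onI continuous_intros)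

section \<open>A strong law for triangular arrays\<close>

context prob_space
begin

text \<open>A single assumption on the fourth moment is to cover every mixed term of the binomial
  expansions below; it suffices that |x|^k <= 1 + x^4 for k <= 4.\<close>

lemma integrable_powers_of_fourth:
  fixes X :: "'a \<Rightarrow> real"
  assumes [measurable]: "random_variable borel X" and X: "integrable M (\<lambda>\<omega>. X \<omega> ^ 4)" and k: "k \<le> 4"
  shows "integrable M (\<lambda>\<omega>. X \<omega> ^ k)"
proof (rule Bochner_Integration.integrable_bound)
  show "integrable M (\<lambda>\<omega>. 1 + X \<omega> ^ 4)" using X by simp
  have "\<bar>x\<bar> ^ k \<le> 1 + x ^ 4" for x :: real
  proof (cases "\<bar>x\<bar> \<le> 1")
    case True
    then have "\<bar>x\<bar> ^ k \<le> 1" by (simp add: power_le_one)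
    then show ?thesis by (smt (verit) zero_le_even_power even_numeral)
  next
    case False
    then have "\<bar>x\<bar> ^ k \<le> \<bar>x\<bar> ^ 4" using k by (intro power_increasing) auto
    then show ?thesis by simp
  qed
  then show "AE \<omega> in M. norm (X \<omega> ^ k) \<le> norm (1 + X \<omega> ^ 4)"
    by (auto simp: power_abs[symmetric] intro: order_trans[OF _ abs_ge_self])
qed simp

text \<open>The difference of the two sides is the variance of X^2.\<close>

lemma square_expectation_le:
  fixes X :: "'a \<Rightarrow> real"
  assumes [measurable]: "random_variable borel X" and X: "integrable M (\<lambda>\<omega>. X \<omega> ^ 4)"
  shows "(expectation (\<lambda>\<omega>. X \<omega> ^ 2))\<^sup>2 \<le> expectation (\<lambda>\<omega>. X \<omega> ^ 4)"
proof -
  let ?m = "expectation (\<lambda>\<omega>. X \<omega> ^ 2)"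
  have X2: "integrable M (\<lambda>\<omega>. X \<omega> ^ 2)" by (rule integrable_powers_of_fourth[OF assms]) simp
  have "0 \<le> expectation (\<lambda>\<omega>. (X \<omega> ^ 2 - ?m)\<^sup>2)" by simp
  also have "(\<lambda>\<omega>. (X \<omega> ^ 2 - ?m)\<^sup>2) = (\<lambda>\<omega>. X \<omega> ^ 4 - 2 * ?m * X \<omega> ^ 2 + ?m\<^sup>2)"
    by (auto simp: fun_eq_iff power2_eq_square algebra_simps power4_eq_xxxx)
  also have "expectation \<dots> = expectation (\<lambda>\<omega>. X \<omega> ^ 4) - 2 * ?m * ?m + ?m\<^sup>2"
    using X X2 by (simp add: prob_space)
  finally show ?thesis by (simp add: power2_eq_square)
qed

text \<open>In the binomial expansion expectations factorise, and every mixed term with odd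
  exponents contains a first moment, which is zero.\<close>

lemma fourth_moment_add_indep:
  fixes X S :: "'a \<Rightarrow> real"
  assumes ind: "indep_var borel X borel S"
    and X: "integrable M (\<lambda>\<omega>. X \<omega> ^ 4)" and S: "integrable M (\<lambda>\<omega>. S \<omega> ^ 4)"
    and X0: "expectation X = 0" and S0: "expectation S = 0"
  shows "integrable M (\<lambda>\<omega>. (X \<omega> + S \<omega>) ^ 4)"
    and "expectation (\<lambda>\<omega>. (X \<omega> + S \<omega>) ^ 4) = expectation (\<lambda>\<omega>. X \<omega> ^ 4)
      + 6 * (expectation (\<lambda>\<omega>. X \<omega> ^ 2) * expectation (\<lambda>\<omega>. S \<omega> ^ 2)) + expectation (\<lambda>\<omega>. S \<omega> ^ 4)"
    and "expectation (\<lambda>\<omega>. (X \<omega> + S \<omega>) ^ 2) = expectation (\<lambda>\<omega>. X \<omega> ^ 2) + expectation (\<lambda>\<omega>. S \<omega> ^ 2)"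
proof -
  have mX: "random_variable borel X" and mS: "random_variable borel S"
    using indep_var_rv1[OF ind] indep_var_rv2[OF ind] .
  have ind': "indep_var borel (\<lambda>\<omega>. X \<omega> ^ i) borel (\<lambda>\<omega>. S \<omega> ^ j)" for i j
    using indep_var_compose[OF ind, of "\<lambda>x. x ^ i" borel "\<lambda>x. x ^ j" borel] by (simp add: o_def)
  note iX = integrable_powers_of_fourth[OF mX X] and iS = integrable_powers_of_fourth[OF mS S]
  have iXS: "integrable M (\<lambda>\<omega>. X \<omega> ^ i * S \<omega> ^ j)"
    and eXS: "expectation (\<lambda>\<omega>. X \<omega> ^ i * S \<omega> ^ j) =
      expectation (\<lambda>\<omega>. X \<omega> ^ i) * expectation (\<lambda>\<omega>. S \<omega> ^ j)" if "i \<le> 4" "j \<le> 4" for i j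
    using indep_var_integrable[OF ind' iX[OF that(1)] iS[OF that(2)]]
      indep_var_lebesgue_integral[OF ind' iX[OF that(1)] iS[OF that(2)]] by auto
  have X1: "expectation (\<lambda>\<omega>. X \<omega> ^ 1) = 0" and S1: "expectation (\<lambda>\<omega>. S \<omega> ^ 1) = 0"
    using X0 S0 by simp_all
  \<comment> \<open>The trivial powers \<open>^ 0\<close> and \<open>^ 1\<close> are kept so that
    every term is a multiple of some \<open>X \<omega> ^ i * S \<omega> ^ j\<close> and one
    factorisation rule serves all of them.\<close>
  have eq: "(\<lambda>\<omega>. (X \<omega> + S \<omega>) ^ 4) = (\<lambda>\<omega>. X \<omega> ^ 4 * S \<omega> ^ 0 + 4 * (X \<omega> ^ 3 * S \<omega> ^ 1)
      + 6 * (X \<omega> ^ 2 * S \<omega> ^ 2) + 4 * (X \<omega> ^ 1 * S \<omega> ^ 3) + X \<omega> ^ 0 * S \<omega> ^ 4)"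
    by (auto simp: fun_eq_iff power4_eq_xxxx power2_eq_square power3_eq_cube algebra_simps)
  show "integrable M (\<lambda>\<omega>. (X \<omega> + S \<omega>) ^ 4)"
    unfolding eq by (intro Bochner_Integration.integrable_add integrable_mult_right iXS) auto
  show "expectation (\<lambda>\<omega>. (X \<omega> + S \<omega>) ^ 4) = expectation (\<lambda>\<omega>. X \<omega> ^ 4)
      + 6 * (expectation (\<lambda>\<omega>. X \<omega> ^ 2) * expectation (\<lambda>\<omega>. S \<omega> ^ 2)) + expectation (\<lambda>\<omega>. S \<omega> ^ 4)"
    unfolding eq
    by (subst Bochner_Integration.integral_add | subst Bochner_Integration.integral_mult_right |
        intro Bochner_Integration.integrable_add integrable_mult_right iXS | simp only: eXS X1 S1 | simp add: prob_space)+
  have eq2: "(\<lambda>\<omega>. (X \<omega> + S \<omega>) ^ 2) = (\<lambda>\<omega>. X \<omega> ^ 2 * S \<omega> ^ 0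
      + 2 * (X \<omega> ^ 1 * S \<omega> ^ 1) + X \<omega> ^ 0 * S \<omega> ^ 2)"
    by (auto simp: fun_eq_iff power2_eq_square algebra_simps)
  show "expectation (\<lambda>\<omega>. (X \<omega> + S \<omega>) ^ 2) = expectation (\<lambda>\<omega>. X \<omega> ^ 2) + expectation (\<lambda>\<omega>. S \<omega> ^ 2)"
    unfolding eq2
    by (subst Bochner_Integration.integral_add | subst Bochner_Integration.integral_mult_right |
        intro Bochner_Integration.integrable_add integrable_mult_right iXS | simp only: eXS X1 S1 | simp add: prob_space)+
qed

text \<open>The induction carries the second moment along, because adding a variable produces the
  cross term 6 E(X^2) E(S^2). As E(X^2) <= sqrt C, this is at most 6nC, and C + 6nC + 3n^2 C <=
  3(n+1)^2 C closes the step; hence the constant 3.\<close>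

lemma fourth_moment_sum_indep:
  fixes X :: "'i \<Rightarrow> 'a \<Rightarrow> real"
  assumes "finite I" "indep_vars (\<lambda>_. borel) X I"
    and "\<And>i. i \<in> I \<Longrightarrow> integrable M (\<lambda>\<omega>. X i \<omega> ^ 4)" "\<And>i. i \<in> I \<Longrightarrow> expectation (X i) = 0"
    and "\<And>i. i \<in> I \<Longrightarrow> expectation (\<lambda>\<omega>. X i \<omega> ^ 4) \<le> C" "0 \<le> C"
  shows "integrable M (\<lambda>\<omega>. (\<Sum>i\<in>I. X i \<omega>) ^ 4) \<and>
    expectation (\<lambda>\<omega>. (\<Sum>i\<in>I. X i \<omega>) ^ 2) \<le> real (card I) * sqrt C \<and>
    expectation (\<lambda>\<omega>. (\<Sum>i\<in>I. X i \<omega>) ^ 4) \<le> 3 * (real (card I))\<^sup>2 * C"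
  using assms(1-5)
proof (induction I rule: finite_induct)
  case empty
  then show ?case by simp
next
  case (insert j I)
  let ?S = "\<lambda>\<omega>. \<Sum>i\<in>I. X i \<omega>" and ?n = "real (card I)"
  have IH: "integrable M (\<lambda>\<omega>. ?S \<omega> ^ 4)" "expectation (\<lambda>\<omega>. ?S \<omega> ^ 2) \<le> ?n * sqrt C"
      "expectation (\<lambda>\<omega>. ?S \<omega> ^ 4) \<le> 3 * ?n\<^sup>2 * C"
    using insert.IH insert.prems indep_vars_subset[OF insert.prems(1), of I] by auto
  have ind: "indep_var borel (X j) borel ?S"
    using insert.hyps insert.prems by (intro indep_vars_sum) auto
  have Xj: "integrable M (\<lambda>\<omega>. X j \<omega> ^ 4)" "expectation (\<lambda>\<omega>. X j \<omega> ^ 4) \<le> C" "expectation (X j) = 0"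
    using insert.prems by auto
  have rv: "random_variable borel (X i)" if "i \<in> insert j I" for i
    using insert.prems(1) that by (auto simp: indep_vars_def)
  have int1: "integrable M (X i)" if "i \<in> insert j I" for i
    using integrable_powers_of_fourth[OF rv[OF that] insert.prems(2)[OF that], of 1] by simp
  have S0: "expectation ?S = 0"
    using int1 insert.prems(3) by (subst Bochner_Integration.integral_sum) auto
  note add = fourth_moment_add_indep[OF ind Xj(1) IH(1) Xj(3) S0]
  have "(expectation (\<lambda>\<omega>. X j \<omega> ^ 2))\<^sup>2 \<le> C"
    using square_expectation_le[OF rv Xj(1)] Xj(2) by simp
  then have X2: "expectation (\<lambda>\<omega>. X j \<omega> ^ 2) \<le> sqrt C" by (rule real_le_rsqrt)
  have "expectation (\<lambda>\<omega>. X j \<omega> ^ 2) * expectation (\<lambda>\<omega>. ?S \<omega> ^ 2) \<le> sqrt C * (?n * sqrt C)"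
    using X2 IH(2) \<open>0 \<le> C\<close> by (intro mult_mono) auto
  also have "\<dots> = ?n * C" using \<open>0 \<le> C\<close> by simp
  finally have "expectation (\<lambda>\<omega>. (X j \<omega> + ?S \<omega>) ^ 4) \<le> C + 6 * (?n * C) + 3 * ?n\<^sup>2 * C"
    unfolding add(2) using Xj(2) IH(3) by simp
  also have "\<dots> \<le> 3 * (?n + 1)\<^sup>2 * C"
    using \<open>0 \<le> C\<close> by (simp add: power2_eq_square algebra_simps)
  finally have "expectation (\<lambda>\<omega>. (X j \<omega> + ?S \<omega>) ^ 4) \<le> 3 * (?n + 1)\<^sup>2 * C" .
  moreover have "expectation (\<lambda>\<omega>. (X j \<omega> + ?S \<omega>) ^ 2) \<le> (?n + 1) * sqrt C"
    unfolding add(3) using X2 IH(2) by (simp add: algebra_simps)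
  ultimately show ?case using insert.hyps add(1) by (simp add: add.commute)
qed

text \<open>A substitute for Borel-Cantelli: by monotone convergence the series of the
  \<open>f T\<close> has finite expectation, so it converges almost surely and its terms tend to
  zero. Only the individual expectations enter, never the joint law over \<open>T\<close>.\<close>

lemma AE_tendsto_zero_if_expectation_summable:
  fixes f :: "nat \<Rightarrow> 'a \<Rightarrow> real"
  assumes int: "\<And>T. integrable M (f T)" and nonneg: "\<And>T \<omega>. 0 \<le> f T \<omega>"
    and summ: "summable (\<lambda>T. expectation (f T))"
  shows "AE \<omega> in M. (\<lambda>T. f T \<omega>) \<longlonglongrightarrow> 0"
proof -
  have [measurable]: "random_variable borel (f T)" for T using int by auto
  have "(\<integral>\<^sup>+\<omega>. (\<Sum>T. ennreal (f T \<omega>)) \<partial>M) = (\<Sum>T. \<integral>\<^sup>+\<omega>. ennreal (f T \<omega>) \<partial>M)"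
    by (rule nn_integral_suminf) measurable
  also have "\<dots> = (\<Sum>T. ennreal (expectation (f T)))"
    by (simp add: nn_integral_eq_integral int nonneg)
  also have "\<dots> < \<infinity>"
    using summ by (subst suminf_ennreal2) (auto intro: integral_nonneg_AE simp: nonneg)
  finally have "AE \<omega> in M. (\<Sum>T. ennreal (f T \<omega>)) \<noteq> \<infinity>"
    by (intro nn_integral_noteq_infinite) auto
  then show ?thesis
  proof eventually_elim
    case (elim \<omega>)
    then have "summable (\<lambda>T. f T \<omega>)"
      by (intro summable_suminf_not_top nonneg) (simp add: top_ennreal_def infinity_ennreal_def)
    then show ?case by (rule summable_LIMSEQ_zero)
  qed
qed

lemma strong_law_triangular_array:
  fixes Y :: "nat \<Rightarrow> nat \<Rightarrow> 'a \<Rightarrow> real"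
  assumes ind: "\<forall>\<^sub>F T in sequentially. indep_vars (\<lambda>_. borel) (Y T) {..<N T}"
    and mom: "\<forall>\<^sub>F T in sequentially. \<forall>n<N T. integrable M (\<lambda>\<omega>. Y T n \<omega> ^ 4) \<and>
      expectation (\<lambda>\<omega>. Y T n \<omega> ^ 4) \<le> B \<and> expectation (Y T n) = 0"
    and N: "(\<lambda>T. real (N T) / real T) \<longlonglongrightarrow> c" "0 < c"
  shows "AE \<omega> in M. (\<lambda>T. (\<Sum>n<N T. Y T n \<omega>) / real (N T)) \<longlonglongrightarrow> 0"
proof -
  \<comment> \<open>The hypotheses hold only for large \<open>T\<close>. Setting \<open>f T\<close>
    to zero for the other \<open>T\<close> makes integrability and the moment bound valid for every
    \<open>T\<close> without changing the limit.\<close>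
  define good where "good T \<longleftrightarrow> indep_vars (\<lambda>_. borel) (Y T) {..<N T} \<and>
    (\<forall>n<N T. integrable M (\<lambda>\<omega>. Y T n \<omega> ^ 4) \<and>
      expectation (\<lambda>\<omega>. Y T n \<omega> ^ 4) \<le> B \<and> expectation (Y T n) = 0)" for T
  have ev_good: "\<forall>\<^sub>F T in sequentially. good T"
    using ind mom unfolding good_def by eventually_elim auto
  \<comment> \<open>\<open>B\<close> has no assumed sign, as it may bound an empty range of rows,
    while the moment inequality asks for a nonnegative constant.\<close>
  define C where "C = max B 0"
  define f where "f T \<omega> = (if good T then ((\<Sum>n<N T. Y T n \<omega>) / real (N T)) ^ 4 else 0)" for T \<omega>
  have *: "integrable M (f T)" "expectation (f T) \<le> 3 * C / (real (N T))\<^sup>2" for T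
  proof (atomize (full), cases "good T")
    case True
    have "integrable M (\<lambda>\<omega>. (\<Sum>n<N T. Y T n \<omega>) ^ 4) \<and>
        expectation (\<lambda>\<omega>. (\<Sum>n<N T. Y T n \<omega>) ^ 2) \<le> real (card {..<N T}) * sqrt C \<and>
        expectation (\<lambda>\<omega>. (\<Sum>n<N T. Y T n \<omega>) ^ 4) \<le> 3 * (real (card {..<N T}))\<^sup>2 * C"
      using True by (intro fourth_moment_sum_indep) (force simp: good_def C_def)+
    then have i: "integrable M (\<lambda>\<omega>. (\<Sum>n<N T. Y T n \<omega>) ^ 4)"
      and e: "expectation (\<lambda>\<omega>. (\<Sum>n<N T. Y T n \<omega>) ^ 4) \<le> 3 * (real (N T))\<^sup>2 * C" by auto
    have eq: "f T = (\<lambda>\<omega>. (\<Sum>n<N T. Y T n \<omega>) ^ 4 / real (N T) ^ 4)"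
      using True by (simp add: f_def fun_eq_iff power_divide)
    have "expectation (f T) = expectation (\<lambda>\<omega>. (\<Sum>n<N T. Y T n \<omega>) ^ 4) / real (N T) ^ 4"
      unfolding eq by simp
    also have "\<dots> \<le> 3 * (real (N T))\<^sup>2 * C / real (N T) ^ 4"
      using e by (intro divide_right_mono) auto
    \<comment> \<open>For \<open>N T = 0\<close> both quotients are 0 by the convention for division
      by zero.\<close>
    also have "\<dots> = 3 * C / (real (N T))\<^sup>2"
      by (cases "N T = 0") (simp_all add: field_simps power4_eq_xxxx power2_eq_square)
    finally show "integrable M (f T) \<and> expectation (f T) \<le> 3 * C / (real (N T))\<^sup>2"
      using i eq by auto
  next
    case False
    then have "f T = (\<lambda>\<omega>. 0)" by (simp add: f_def fun_eq_iff)
    then show "integrable M (f T) \<and> expectation (f T) \<le> 3 * C / (real (N T))\<^sup>2"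
      by (simp add: C_def)
  qed
  have nonneg: "0 \<le> f T \<omega>" for T \<omega> by (simp add: f_def)
  have "\<forall>\<^sub>F T in sequentially. c / 2 < real (N T) / real T"
    using N by (intro order_tendstoD) auto
  \<comment> \<open>Eventually N T >= c T / 2, and 3C / (cT/2)^2 = 12C / (c^2 T^2) is a summable
    majorant.\<close>
  then have "\<forall>\<^sub>F T in sequentially.
      norm (expectation (f T)) \<le> 12 * C / c\<^sup>2 * (1 / (real T)\<^sup>2)"
    using eventually_gt_at_top[of 0]
  proof eventually_elim
    case (elim T)
    then have "c * real T / 2 \<le> real (N T)" by (simp add: field_simps)
    moreover have "0 < c * real T / 2" using elim N(2) by simp
    ultimately have "0 < real (N T)" by linarith
    have "(c * real T / 2)\<^sup>2 \<le> (real (N T))\<^sup>2"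
      using \<open>c * real T / 2 \<le> real (N T)\<close> elim N(2) by (intro power_mono) auto
    then have "3 * C / (real (N T))\<^sup>2 \<le> 3 * C / (c * real T / 2)\<^sup>2"
      using elim N(2) \<open>0 < real (N T)\<close> by (intro divide_left_mono) (auto simp: C_def)
    moreover have "3 * C / (c * real T / 2)\<^sup>2 = 12 * C / c\<^sup>2 * (1 / (real T)\<^sup>2)"
      by (simp add: power_divide power_mult_distrib)
    moreover have "0 \<le> expectation (f T)" by (simp add: nonneg)
    ultimately show ?case using *(2)[of T] by simp
  qed
  moreover have "summable (\<lambda>T. 12 * C / c\<^sup>2 * (1 / (real T)\<^sup>2))"
    using inverse_power_summable[of 2, where 'a = real] by (intro summable_mult) (simp add: field_simps)
  ultimately have "summable (\<lambda>T. expectation (f T))"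
    by (rule summable_comparison_test_ev)
  from AE_tendsto_zero_if_expectation_summable[OF *(1) nonneg this]
  show ?thesis
  proof eventually_elim
    case (elim \<omega>)
    \<comment> \<open>The fourth root undoes the power: for good \<open>T\<close> it returns the
      absolute value of the mean.\<close>
    have "(\<lambda>T. root 4 (f T \<omega>)) \<longlonglongrightarrow> root 4 0"
      using elim by (intro tendsto_real_root)
    then have "(\<lambda>T. root 4 (f T \<omega>)) \<longlonglongrightarrow> 0" by simp
    moreover have "\<forall>\<^sub>F T in sequentially. root 4 (f T \<omega>) = \<bar>(\<Sum>n<N T. Y T n \<omega>) / real (N T)\<bar>"
      using ev_good
    proof eventually_elim
      case (elim T)
      have "root 4 (x ^ 4) = \<bar>x\<bar>" for x :: real
        using real_root_power_cancel[of 4 "\<bar>x\<bar>"] by (simp add: power_even_abs)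
      from this[of "(\<Sum>n<N T. Y T n \<omega>) / real (N T)"] show ?case
        using elim by (simp add: f_def)
    qed
    ultimately have "(\<lambda>T. \<bar>(\<Sum>n<N T. Y T n \<omega>) / real (N T)\<bar>) \<longlonglongrightarrow> 0"
      by (rule Lim_transform_eventually)
    then show ?case by (simp only: tendsto_rabs_zero_iff)
  qed
qed

text \<open>After centring by \<open>m T\<close>, the real law applies to the real and imaginary
  parts; the means are added back through their own limit.\<close>

lemma strong_law_triangular_array_complex:
  fixes Y :: "nat \<Rightarrow> nat \<Rightarrow> 'a \<Rightarrow> complex"
  assumes ind: "\<forall>\<^sub>F T in sequentially. indep_vars (\<lambda>_. borel) (Y T) {..<N T}"
    and mom: "\<forall>\<^sub>F T in sequentially. \<forall>n<N T. integrable M (\<lambda>\<omega>. cmod (Y T n \<omega>) ^ 4) \<and>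
      expectation (\<lambda>\<omega>. cmod (Y T n \<omega>) ^ 4) \<le> B \<and> expectation (Y T n) = m T"
    and N: "(\<lambda>T. real (N T) / real T) \<longlonglongrightarrow> c" "0 < c"
    and m: "m \<longlonglongrightarrow> \<mu>"
  shows "AE \<omega> in M. (\<lambda>T. (\<Sum>n<N T. Y T n \<omega>) / of_nat (N T)) \<longlonglongrightarrow> \<mu>"
proof -
  have ev_N: "\<forall>\<^sub>F T in sequentially. 0 < N T"
    using order_tendstoD(1)[OF N] by eventually_elim (auto intro: gr0I)
  \<comment> \<open>Real and imaginary part are treated at once as a bounded linear functional
    \<open>F\<close> that never exceeds the modulus.\<close>
  have part: "AE \<omega> in M. (\<lambda>T. (\<Sum>n<N T. F (Y T n \<omega> - m T)) / real (N T)) \<longlonglongrightarrow> 0"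
    if F: "bounded_linear F" "\<And>z. \<bar>F z\<bar> \<le> cmod z" for F :: "complex \<Rightarrow> real"
  proof (rule strong_law_triangular_array[OF _ _ N])
    interpret F: bounded_linear F by (rule F)
    have F_meas [measurable]: "F \<in> borel_measurable borel"
      by (intro borel_measurable_continuous_onI linear_continuous_on F)
    show "\<forall>\<^sub>F T in sequentially. indep_vars (\<lambda>_. borel) (\<lambda>n \<omega>. F (Y T n \<omega> - m T)) {..<N T}"
      using ind
    proof eventually_elim
      case (elim T)
      show ?case by (rule indep_vars_compose2[OF elim]) measurable
    qed
    \<comment> \<open>The bound combines F(y - m)^4 <= 8|y|^4 + 8|m|^4 with |m|^4 <= B, which gives
      16 B; the additional 16 is slack.\<close>
    show "\<forall>\<^sub>F T in sequentially. \<forall>n<N T. integrable M (\<lambda>\<omega>. F (Y T n \<omega> - m T) ^ 4) \<and>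
      expectation (\<lambda>\<omega>. F (Y T n \<omega> - m T) ^ 4) \<le> 16 * (1 + B) \<and>
      expectation (\<lambda>\<omega>. F (Y T n \<omega> - m T)) = 0"
      using mom ind
    proof eventually_elim
      case (elim T)
      show ?case
      proof (intro allI impI)
        fix n assume n: "n < N T"
        have [measurable]: "random_variable borel (Y T n)"
          using elim(2) n by (auto simp: indep_vars_def)
        have i4: "integrable M (\<lambda>\<omega>. cmod (Y T n \<omega>) ^ 4)"
          and e4: "expectation (\<lambda>\<omega>. cmod (Y T n \<omega>) ^ 4) \<le> B" and e: "expectation (Y T n) = m T"
          using elim(1) n by auto
        have i1: "integrable M (Y T n)"
          using integrable_powers_of_fourth[OF _ i4, of 1] by (simp add: integrable_norm_iff)
        have i2: "integrable M (\<lambda>\<omega>. (cmod (Y T n \<omega>))\<^sup>2)"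
          using integrable_powers_of_fourth[OF _ i4, of 2] by simp
        \<comment> \<open>Jensen's inequality in two squarings: the variance of |Y| is nonnegative,
          and then so is that of |Y|^2.\<close>
        have jens: "cmod (m T) ^ 4 \<le> B"
        proof -
          have "cmod (m T) \<le> expectation (\<lambda>\<omega>. cmod (Y T n \<omega>))"
            unfolding e[symmetric] by (rule integral_norm_bound)
          then have "(cmod (m T))\<^sup>2 \<le> (expectation (\<lambda>\<omega>. cmod (Y T n \<omega>)))\<^sup>2"
            by (intro power_mono) auto
          also have "\<dots> \<le> expectation (\<lambda>\<omega>. (cmod (Y T n \<omega>))\<^sup>2)"
            using variance_eq[of "\<lambda>\<omega>. cmod (Y T n \<omega>)"] i1 i2 variance_positive[of "\<lambda>\<omega>. cmod (Y T n \<omega>)"]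
            by simp
          finally have "((cmod (m T))\<^sup>2)\<^sup>2 \<le> (expectation (\<lambda>\<omega>. (cmod (Y T n \<omega>))\<^sup>2))\<^sup>2"
            by (intro power_mono) auto
          also have "\<dots> \<le> B" using square_expectation_le[OF _ i4] e4 by simp
          finally show ?thesis by simp
        qed
        have bound: "F (y - m T) ^ 4 \<le> 8 * cmod y ^ 4 + 8 * cmod (m T) ^ 4" for y
        proof -
          have "\<bar>F (y - m T)\<bar> \<le> cmod y + cmod (m T)"
            using F(2)[of "y - m T"] norm_triangle_ineq4[of y "m T"] by linarith
          then have "\<bar>F (y - m T)\<bar> ^ 4 \<le> (cmod y + cmod (m T)) ^ 4" by (rule power_mono) simp
          also have "\<dots> = ((cmod y + cmod (m T))\<^sup>2)\<^sup>2" by simp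
          also have "\<dots> \<le> (2 * (cmod y)\<^sup>2 + 2 * (cmod (m T))\<^sup>2)\<^sup>2"
            using sum_squares_bound[of "cmod y" "cmod (m T)"]
            by (intro power_mono) (auto simp: power2_sum)
          also have "\<dots> \<le> 8 * cmod y ^ 4 + 8 * cmod (m T) ^ 4"
            using sum_squares_bound[of "(cmod y)\<^sup>2" "(cmod (m T))\<^sup>2"]
            by (simp add: power2_sum power_mult_distrib)
          finally show ?thesis by simp
        qed
        have ib: "integrable M (\<lambda>\<omega>. 8 * cmod (Y T n \<omega>) ^ 4 + 8 * cmod (m T) ^ 4)"
          using i4 by simp
        have iF: "integrable M (\<lambda>\<omega>. F (Y T n \<omega> - m T) ^ 4)"
          using bound by (intro Bochner_Integration.integrable_bound[OF ib]) (auto simp: add_nonneg_nonneg)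
        have "expectation (\<lambda>\<omega>. F (Y T n \<omega> - m T) ^ 4) \<le>
            expectation (\<lambda>\<omega>. 8 * cmod (Y T n \<omega>) ^ 4 + 8 * cmod (m T) ^ 4)"
          using bound by (intro integral_mono iF ib)
        also have "\<dots> \<le> 16 * (1 + B)" using i4 e4 jens by (simp add: prob_space)
        finally have le: "expectation (\<lambda>\<omega>. F (Y T n \<omega> - m T) ^ 4) \<le> 16 * (1 + B)" .
        have "expectation (\<lambda>\<omega>. F (Y T n \<omega> - m T)) = F (expectation (\<lambda>\<omega>. Y T n \<omega> - m T))"
          using i1 by (intro integral_bounded_linear F) auto
        also have "\<dots> = 0" using i1 e by (simp add: prob_space F.zero)
        finally show "integrable M (\<lambda>\<omega>. F (Y T n \<omega> - m T) ^ 4) \<and>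
          expectation (\<lambda>\<omega>. F (Y T n \<omega> - m T) ^ 4) \<le> 16 * (1 + B) \<and>
          expectation (\<lambda>\<omega>. F (Y T n \<omega> - m T)) = 0" using iF le by blast
      qed
    qed
  qed
  have "AE \<omega> in M. (\<lambda>T. (\<Sum>n<N T. Re (Y T n \<omega> - m T)) / real (N T)) \<longlonglongrightarrow> 0"
    by (rule part) (auto intro: bounded_linear_Re abs_Re_le_cmod)
  moreover have "AE \<omega> in M. (\<lambda>T. (\<Sum>n<N T. Im (Y T n \<omega> - m T)) / real (N T)) \<longlonglongrightarrow> 0"
    by (rule part) (auto intro: bounded_linear_Im abs_Im_le_cmod)
  ultimately show ?thesis
  proof eventually_elim
    case (elim \<omega>)
    let ?D = "\<lambda>T. Complex ((\<Sum>n<N T. Re (Y T n \<omega> - m T)) / real (N T))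
      ((\<Sum>n<N T. Im (Y T n \<omega> - m T)) / real (N T))"
    have "?D \<longlonglongrightarrow> Complex 0 0" by (intro tendsto_Complex elim)
    from tendsto_add[OF this m] have "(\<lambda>T. ?D T + m T) \<longlonglongrightarrow> \<mu>" by (simp flip: zero_complex.code)
    moreover have "\<forall>\<^sub>F T in sequentially. ?D T + m T = (\<Sum>n<N T. Y T n \<omega>) / of_nat (N T)"
      using ev_N
    proof eventually_elim
      case (elim T)
      then show ?case
        by (simp add: complex_eq_iff Re_divide_of_nat Im_divide_of_nat sum_subtractf diff_divide_distrib)
    qed
    ultimately show ?case by (rule Lim_transform_eventually)
  qed
qed

end

section \<open>Moments and independence of pairs\<close>

text \<open>Cauchy-Schwarz twice, each time against the constant 1: the cardinality enters once, is
  squared, and enters once more.\<close>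

lemma sum_fourth_power_le:
  fixes f :: "'i \<Rightarrow> real"
  shows "(\<Sum>i\<in>I. f i) ^ 4 \<le> real (card I) ^ 3 * (\<Sum>i\<in>I. f i ^ 4)"
proof -
  let ?n = "real (card I)"
  have "(\<Sum>i\<in>I. f i)\<^sup>2 \<le> ?n * (\<Sum>i\<in>I. (f i)\<^sup>2)"
    using sum_squared_le_sum_of_squares[of f I] by (simp add: mult.commute)
  then have "((\<Sum>i\<in>I. f i)\<^sup>2)\<^sup>2 \<le> (?n * (\<Sum>i\<in>I. (f i)\<^sup>2))\<^sup>2" by (intro power_mono) auto
  also have "\<dots> = ?n\<^sup>2 * (\<Sum>i\<in>I. (f i)\<^sup>2)\<^sup>2" by (simp add: power_mult_distrib)
  also have "\<dots> \<le> ?n\<^sup>2 * (?n * (\<Sum>i\<in>I. ((f i)\<^sup>2)\<^sup>2))"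
    using sum_squared_le_sum_of_squares[of "\<lambda>i. (f i)\<^sup>2" I]
    by (intro mult_left_mono) (auto simp: mult.commute)
  also have "\<dots> = ?n ^ 3 * (\<Sum>i\<in>I. f i ^ 4)"
    by (simp add: power2_eq_square power3_eq_cube power4_eq_xxxx mult.assoc)
  finally show ?thesis by simp
qed

lemma power2_le_one_plus_power8: "(x::real)\<^sup>2 \<le> 1 + x ^ 8"
proof (cases "\<bar>x\<bar> \<le> 1")
  case True
  then have "x\<^sup>2 \<le> 1" by (simp add: abs_square_le_1)
  then show ?thesis by (smt (verit) zero_le_even_power even_numeral)
next
  case False
  then have "\<bar>x\<bar>\<^sup>2 \<le> \<bar>x\<bar> ^ 8" by (intro power_increasing) auto
  then show ?thesis by simp
qed

lemma power2_add_le: "((u::real) + v)\<^sup>2 \<le> 2 * u\<^sup>2 + 2 * v\<^sup>2"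
  using sum_squares_bound[of u v] by (simp add: power2_sum)

text \<open>Three rounds of (u + v)^2 <= 2u^2 + 2v^2 under repeated squaring, with constants 2, 8
  and 128.\<close>

lemma add_power8_le: "((a::real) + b) ^ 8 \<le> 128 * (a ^ 8 + b ^ 8)"
proof -
  have "((a + b)\<^sup>2)\<^sup>2 \<le> (2 * a\<^sup>2 + 2 * b\<^sup>2)\<^sup>2" by (intro power_mono power2_add_le) auto
  also have "\<dots> \<le> 2 * (2 * a\<^sup>2)\<^sup>2 + 2 * (2 * b\<^sup>2)\<^sup>2" by (rule power2_add_le)
  also have "\<dots> = 8 * a ^ 4 + 8 * b ^ 4" by (simp add: power_mult_distrib)
  finally have "(((a + b)\<^sup>2)\<^sup>2)\<^sup>2 \<le> (8 * a ^ 4 + 8 * b ^ 4)\<^sup>2" by (intro power_mono) auto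
  also have "\<dots> \<le> 2 * (8 * a ^ 4)\<^sup>2 + 2 * (8 * b ^ 4)\<^sup>2" by (rule power2_add_le)
  finally show ?thesis by (simp add: power_mult_distrib)
qed

context prob_space
begin

lemma integrable_norm_power2_of_power8:
  fixes Z :: "'a \<Rightarrow> complex"
  assumes [measurable]: "random_variable borel Z" and "integrable M (\<lambda>\<omega>. cmod (Z \<omega>) ^ 8)"
  shows "integrable M (\<lambda>\<omega>. (cmod (Z \<omega>))\<^sup>2)"
  by (rule Bochner_Integration.integrable_bound[where f = "\<lambda>\<omega>. 1 + cmod (Z \<omega>) ^ 8"])
     (use assms(2) power2_le_one_plus_power8 in \<open>auto simp: add_nonneg_nonneg\<close>)

lemma integrable_of_norm_power2:
  fixes Z :: "'a \<Rightarrow> complex"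
  assumes [measurable]: "random_variable borel Z" and "integrable M (\<lambda>\<omega>. (cmod (Z \<omega>))\<^sup>2)"
  shows "integrable M Z"
proof (rule Bochner_Integration.integrable_bound[where f = "\<lambda>\<omega>. 1 + (cmod (Z \<omega>))\<^sup>2"])
  have "x \<le> 1 + x\<^sup>2" if "0 \<le> x" for x :: real
    using sum_squares_bound[of x 1] that by simp
  then show "AE \<omega> in M. norm (Z \<omega>) \<le> norm (1 + (cmod (Z \<omega>))\<^sup>2)"
    by (auto simp: add_nonneg_nonneg)
qed (use assms(2) in auto)

lemma integrable_mult_cnj:
  fixes X Y :: "'a \<Rightarrow> complex"
  assumes [measurable]: "random_variable borel X" "random_variable borel Y"
    and i: "integrable M (\<lambda>\<omega>. (cmod (X \<omega>))\<^sup>2)" "integrable M (\<lambda>\<omega>. (cmod (Y \<omega>))\<^sup>2)"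
  shows "integrable M (\<lambda>\<omega>. X \<omega> * cnj (Y \<omega>))"
proof (rule Bochner_Integration.integrable_bound)
  show "integrable M (\<lambda>\<omega>. (cmod (X \<omega>))\<^sup>2 + (cmod (Y \<omega>))\<^sup>2)" using i by simp
  have "a * b \<le> a\<^sup>2 + b\<^sup>2" if "0 \<le> a" "0 \<le> b" for a b :: real
    using sum_squares_bound[of a b] mult_nonneg_nonneg[OF that] by simp
  then show "AE \<omega> in M. norm (X \<omega> * cnj (Y \<omega>)) \<le> norm ((cmod (X \<omega>))\<^sup>2 + (cmod (Y \<omega>))\<^sup>2)"
    by (auto simp: norm_mult)
qed measurable

text \<open>Bounding the eighth moment by a power of the second makes it uniform wherever the
  variance is fixed. The two deviations may differ or vanish, and the joint law of the parts does
  not enter, since |z|^8 <= 8 (Re z)^8 + 8 (Im z)^8 separates them.\<close>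

lemma complex_gaussian_moments:
  fixes Z :: "'a \<Rightarrow> complex"
  assumes [measurable]: "random_variable borel Z"
    and Re: "distr M borel (\<lambda>\<omega>. Re (Z \<omega>)) = normal_law 0 s" "0 \<le> s"
    and Im: "distr M borel (\<lambda>\<omega>. Im (Z \<omega>)) = normal_law 0 t" "0 \<le> t"
  shows "integrable M (\<lambda>\<omega>. cmod (Z \<omega>) ^ 8)" "expectation (\<lambda>\<omega>. (cmod (Z \<omega>))\<^sup>2) = s\<^sup>2 + t\<^sup>2"
    "expectation (\<lambda>\<omega>. cmod (Z \<omega>) ^ 8) \<le> 840 * (s\<^sup>2 + t\<^sup>2) ^ 4"
    "integrable M Z" "expectation Z = 0"
proof -
  have mR: "random_variable borel (\<lambda>\<omega>. Re (Z \<omega>))" and mI: "random_variable borel (\<lambda>\<omega>. Im (Z \<omega>))"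
    by measurable
  note R = normal_rv_even_moment[OF mR Re, of 4] normal_rv_even_moment[OF mR Re, of 1]
  note I = normal_rv_even_moment[OF mI Im, of 4] normal_rv_even_moment[OF mI Im, of 1]
  \<comment> \<open>105 = 8!/(2^4 4!) is the eighth moment of the standard normal law; 840 is 8
    times 105.\<close>
  have iR: "integrable M (\<lambda>\<omega>. Re (Z \<omega>) ^ 8)" "integrable M (\<lambda>\<omega>. Re (Z \<omega>) ^ 2)"
    and eR: "expectation (\<lambda>\<omega>. Re (Z \<omega>) ^ 8) = 105 * s ^ 8" "expectation (\<lambda>\<omega>. Re (Z \<omega>) ^ 2) = s\<^sup>2"
    using R by (simp_all add: fact_numeral)
  have iI: "integrable M (\<lambda>\<omega>. Im (Z \<omega>) ^ 8)" "integrable M (\<lambda>\<omega>. Im (Z \<omega>) ^ 2)"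
    and eI: "expectation (\<lambda>\<omega>. Im (Z \<omega>) ^ 8) = 105 * t ^ 8" "expectation (\<lambda>\<omega>. Im (Z \<omega>) ^ 2) = t\<^sup>2"
    using I by (simp_all add: fact_numeral)
  show "expectation (\<lambda>\<omega>. (cmod (Z \<omega>))\<^sup>2) = s\<^sup>2 + t\<^sup>2"
    using iR iI eR eI by (simp add: cmod_power2)
  have le: "cmod z ^ 8 \<le> 8 * (Re z ^ 8 + Im z ^ 8)" for z
  proof -
    have "cmod z ^ 8 = (((cmod z)\<^sup>2)\<^sup>2)\<^sup>2" by simp
    also have "\<dots> = (((Re z)\<^sup>2 + (Im z)\<^sup>2)\<^sup>2)\<^sup>2" by (simp only: cmod_power2)
    also have "\<dots> \<le> (2 * ((Re z)\<^sup>2)\<^sup>2 + 2 * ((Im z)\<^sup>2)\<^sup>2)\<^sup>2" by (intro power_mono power2_add_le) auto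
    also have "\<dots> \<le> 2 * (2 * ((Re z)\<^sup>2)\<^sup>2)\<^sup>2 + 2 * (2 * ((Im z)\<^sup>2)\<^sup>2)\<^sup>2" by (rule power2_add_le)
    finally show ?thesis by (simp add: power_mult_distrib)
  qed
  have i8: "integrable M (\<lambda>\<omega>. 8 * (Re (Z \<omega>) ^ 8 + Im (Z \<omega>) ^ 8))"
    using iR iI by simp
  show i: "integrable M (\<lambda>\<omega>. cmod (Z \<omega>) ^ 8)"
    by (rule Bochner_Integration.integrable_bound[OF i8]) (use le in \<open>auto simp: add_nonneg_nonneg\<close>)
  have "expectation (\<lambda>\<omega>. cmod (Z \<omega>) ^ 8) \<le> expectation (\<lambda>\<omega>. 8 * (Re (Z \<omega>) ^ 8 + Im (Z \<omega>) ^ 8))"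
    using le by (intro integral_mono i i8)
  also have "\<dots> = 840 * ((s\<^sup>2) ^ 4 + (t\<^sup>2) ^ 4)" using iR iI eR eI by simp
  also have "\<dots> \<le> 840 * (s\<^sup>2 + t\<^sup>2) ^ 4"
  proof -
    have "a ^ 4 + b ^ 4 \<le> (a + b) ^ 4" if "0 \<le> a" "0 \<le> b" for a b :: real
    proof -
      have "(a + b) ^ 4 = a ^ 4 + b ^ 4 + (4 * a ^ 3 * b + 6 * a\<^sup>2 * b\<^sup>2 + 4 * a * b ^ 3)"
        by (simp add: power4_eq_xxxx power3_eq_cube power2_eq_square algebra_simps)
      moreover have "0 \<le> 4 * a ^ 3 * b + 6 * a\<^sup>2 * b\<^sup>2 + 4 * a * b ^ 3" using that by simp
      ultimately show ?thesis by linarith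
    qed
    from this[of "s\<^sup>2" "t\<^sup>2"] show ?thesis by simp
  qed
  finally show "expectation (\<lambda>\<omega>. cmod (Z \<omega>) ^ 8) \<le> 840 * (s\<^sup>2 + t\<^sup>2) ^ 4" .
  show iZ: "integrable M Z"
    by (intro integrable_of_norm_power2 integrable_norm_power2_of_power8 i) measurable
  show "expectation Z = 0"
    using iZ normal_rv_mean(2)[OF mR Re] normal_rv_mean(2)[OF mI Im] by (simp add: complex_eq_iff)
qed

lemma complex_normal_moments:
  assumes Z: "random_variable borel Z" and law: "distr M borel Z = complex_normal_law (\<sigma>\<^sup>2)"
  shows "integrable M (\<lambda>\<omega>. cmod (Z \<omega>) ^ 8)" "expectation (\<lambda>\<omega>. (cmod (Z \<omega>))\<^sup>2) = \<sigma>\<^sup>2"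
    "expectation (\<lambda>\<omega>. cmod (Z \<omega>) ^ 8) \<le> 840 * \<sigma> ^ 8"
    "integrable M Z" "expectation Z = 0"
proof -
  have s: "0 \<le> sqrt (\<sigma>\<^sup>2 / 2)" by simp
  have v: "0 \<le> \<sigma>\<^sup>2" by simp
  note * = complex_gaussian_moments[OF Z complex_normal_law_Re_Im(1)[OF Z law v] s
      complex_normal_law_Re_Im(2)[OF Z law v] s]
  show "integrable M (\<lambda>\<omega>. cmod (Z \<omega>) ^ 8)" "expectation (\<lambda>\<omega>. (cmod (Z \<omega>))\<^sup>2) = \<sigma>\<^sup>2"
    "expectation (\<lambda>\<omega>. cmod (Z \<omega>) ^ 8) \<le> 840 * \<sigma> ^ 8"
    "integrable M Z" "expectation Z = 0"
    using * by (simp_all add: power_divide)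
qed

text \<open>Made to join the signal of each row to its noise. Rectangles form an intersection-stable
  generator, so it suffices to factorise their probabilities: between \<open>U\<close> and
  \<open>V\<close>, then over the index within each family, and back into pairs by independence of
  \<open>U\<close> and \<open>V\<close> at each single index.\<close>

lemma indep_vars_Pair:
  assumes I: "finite I" and ind: "indep_var S U S' V"
    and f: "\<And>i. i \<in> I \<Longrightarrow> f i \<in> measurable S (A i)" and g: "\<And>i. i \<in> I \<Longrightarrow> g i \<in> measurable S' (B i)"
    and fU: "indep_vars A (\<lambda>i \<omega>. f i (U \<omega>)) I" and gV: "indep_vars B (\<lambda>i \<omega>. g i (V \<omega>)) I"
  shows "indep_vars (\<lambda>i. A i \<Otimes>\<^sub>M B i) (\<lambda>i \<omega>. (f i (U \<omega>), g i (V \<omega>))) I"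
proof (cases "I = {}")
  case True
  then show ?thesis by (simp add: indep_vars_def indep_sets_def)
next
  case ne: False
  have U [measurable]: "U \<in> measurable M S" and V [measurable]: "V \<in> measurable M S'"
    using indep_var_rv1[OF ind] indep_var_rv2[OF ind] .
  note f [measurable] g [measurable]
  let ?E = "\<lambda>i. {a \<times> b | a b. a \<in> sets (A i) \<and> b \<in> sets (B i)}"
  show ?thesis
  proof (subst indep_vars_finite[where E = ?E])
    show "I \<noteq> {}" "finite I" by fact+
    show "sets (A i \<Otimes>\<^sub>M B i) = sigma_sets (space (A i \<Otimes>\<^sub>M B i)) (?E i)" for i
      by (simp add: sets_pair_measure space_pair_measure)
    show "random_variable (A i \<Otimes>\<^sub>M B i) (\<lambda>\<omega>. (f i (U \<omega>), g i (V \<omega>)))" if "i \<in> I" for i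
      using that by measurable
    show "Int_stable (?E i)" for i by (rule Int_stable_pair_measure_generator)
    show "space (A i \<Otimes>\<^sub>M B i) \<in> ?E i" for i by (auto simp: space_pair_measure)
    show "?E i \<subseteq> Pow (space (A i \<Otimes>\<^sub>M B i))" for i
      by (auto simp: space_pair_measure dest: sets.sets_into_space)
    show "\<forall>C\<in>Pi I ?E. prob (\<Inter>j\<in>I. (\<lambda>\<omega>. (f j (U \<omega>), g j (V \<omega>))) -` C j \<inter> space M) =
      (\<Prod>j\<in>I. prob ((\<lambda>\<omega>. (f j (U \<omega>), g j (V \<omega>))) -` C j \<inter> space M))"
    proof
      fix C assume "C \<in> Pi I ?E"
      then have "\<forall>j\<in>I. \<exists>a b. C j = a \<times> b \<and> a \<in> sets (A j) \<and> b \<in> sets (B j)" by (auto simp: Pi_def)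
      then obtain a b where C: "\<And>j. j \<in> I \<Longrightarrow> C j = a j \<times> b j"
        and a [measurable]: "\<And>j. j \<in> I \<Longrightarrow> a j \<in> sets (A j)"
        and b [measurable]: "\<And>j. j \<in> I \<Longrightarrow> b j \<in> sets (B j)"
        by metis
      have sp: "U \<omega> \<in> space S" "V \<omega> \<in> space S'" if "\<omega> \<in> space M" for \<omega>
        using that measurable_space[OF U] measurable_space[OF V] by auto
      have prod: "prob ({\<omega>\<in>space M. U \<omega> \<in> P} \<inter> {\<omega>\<in>space M. V \<omega> \<in> Q}) =
          prob {\<omega>\<in>space M. U \<omega> \<in> P} * prob {\<omega>\<in>space M. V \<omega> \<in> Q}"
        if "P \<in> sets S" "Q \<in> sets S'" for P Q
        using indep_varD[OF ind that]
        by (simp add: vimage_def Int_def conj_ac cong: conj_cong)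
      let ?P = "\<lambda>j. f j -` a j \<inter> space S" and ?Q = "\<lambda>j. g j -` b j \<inter> space S'"
      have PQ: "?P j \<in> sets S" "?Q j \<in> sets S'" if "j \<in> I" for j
        using that measurable_sets[OF f a] measurable_sets[OF g b] by auto
      have P: "(\<Inter>j\<in>I. ?P j) \<in> sets S" and Q: "(\<Inter>j\<in>I. ?Q j) \<in> sets S'"
        using PQ I ne by (auto intro!: sets.finite_INT)
      \<comment> \<open>A family of rectangle constraints asks for all constraints on
        \<open>U\<close> and all constraints on \<open>V\<close>, so it is the intersection of one
        event for each of the two variables.\<close>
      have "(\<Inter>j\<in>I. (\<lambda>\<omega>. (f j (U \<omega>), g j (V \<omega>))) -` C j \<inter> space M) =
          {\<omega>\<in>space M. U \<omega> \<in> (\<Inter>j\<in>I. ?P j)} \<inter> {\<omega>\<in>space M. V \<omega> \<in> (\<Inter>j\<in>I. ?Q j)}"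
        using ne sp by (auto simp: C)
      then have "prob (\<Inter>j\<in>I. (\<lambda>\<omega>. (f j (U \<omega>), g j (V \<omega>))) -` C j \<inter> space M) =
          prob {\<omega>\<in>space M. U \<omega> \<in> (\<Inter>j\<in>I. ?P j)} * prob {\<omega>\<in>space M. V \<omega> \<in> (\<Inter>j\<in>I. ?Q j)}"
        using prod[OF P Q] by simp
      also have "{\<omega>\<in>space M. U \<omega> \<in> (\<Inter>j\<in>I. ?P j)} = (\<Inter>j\<in>I. (\<lambda>\<omega>. f j (U \<omega>)) -` a j \<inter> space M)"
        using ne sp by auto
      also have "{\<omega>\<in>space M. V \<omega> \<in> (\<Inter>j\<in>I. ?Q j)} = (\<Inter>j\<in>I. (\<lambda>\<omega>. g j (V \<omega>)) -` b j \<inter> space M)"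
        using ne sp by auto
      also have "prob (\<Inter>j\<in>I. (\<lambda>\<omega>. f j (U \<omega>)) -` a j \<inter> space M) =
          (\<Prod>j\<in>I. prob ((\<lambda>\<omega>. f j (U \<omega>)) -` a j \<inter> space M))"
        by (rule indep_varsD_finite[OF fU ne I a])
      also have "prob (\<Inter>j\<in>I. (\<lambda>\<omega>. g j (V \<omega>)) -` b j \<inter> space M) =
          (\<Prod>j\<in>I. prob ((\<lambda>\<omega>. g j (V \<omega>)) -` b j \<inter> space M))"
        by (rule indep_varsD_finite[OF gV ne I b])
      \<comment> \<open>Independence of \<open>U\<close> and \<open>V\<close>, now used at a single
        index, merges each product of two probabilities into that of one rectangle.\<close>
      also have "(\<Prod>j\<in>I. prob ((\<lambda>\<omega>. f j (U \<omega>)) -` a j \<inter> space M)) *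
          (\<Prod>j\<in>I. prob ((\<lambda>\<omega>. g j (V \<omega>)) -` b j \<inter> space M)) =
          (\<Prod>j\<in>I. prob ((\<lambda>\<omega>. (f j (U \<omega>), g j (V \<omega>))) -` C j \<inter> space M))"
        unfolding prod.distrib[symmetric]
      proof (rule prod.cong)
        fix j assume j: "j \<in> I"
        have "(\<lambda>\<omega>. (f j (U \<omega>), g j (V \<omega>))) -` C j \<inter> space M =
            {\<omega>\<in>space M. U \<omega> \<in> ?P j} \<inter> {\<omega>\<in>space M. V \<omega> \<in> ?Q j}"
          using j sp by (auto simp: C)
        moreover have "{\<omega>\<in>space M. U \<omega> \<in> ?P j} = (\<lambda>\<omega>. f j (U \<omega>)) -` a j \<inter> space M"
          "{\<omega>\<in>space M. V \<omega> \<in> ?Q j} = (\<lambda>\<omega>. g j (V \<omega>)) -` b j \<inter> space M"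
          using sp by auto
        ultimately show "prob ((\<lambda>\<omega>. f j (U \<omega>)) -` a j \<inter> space M) *
            prob ((\<lambda>\<omega>. g j (V \<omega>)) -` b j \<inter> space M) =
            prob ((\<lambda>\<omega>. (f j (U \<omega>), g j (V \<omega>))) -` C j \<inter> space M)"
          using prod[OF PQ[OF j]] by simp
      qed simp
      finally show "prob (\<Inter>j\<in>I. (\<lambda>\<omega>. (f j (U \<omega>), g j (V \<omega>))) -` C j \<inter> space M) =
        (\<Prod>j\<in>I. prob ((\<lambda>\<omega>. (f j (U \<omega>), g j (V \<omega>))) -` C j \<inter> space M))" .
    qed
  qed
qed

end

section \<open>The observation model\<close>

context ar_observation_model
begin

section \<open>Moments of signal, noise and innovation\<close>

lemma w_measurable:
  assumes "n < N" "0 \<le> t" "t < int T"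
  shows "random_variable borel (w n t)"
  using w_indep assms by (auto simp: indep_vars_def)

lemma x_measurable: "n < N \<Longrightarrow> random_variable borel (x n t)"
  using x_indep by (auto simp: indep_vars_def)

text \<open>Gaussianity, applied to combinations supported at the single time \<open>t\<close>,
  yields normal laws for both parts with unnamed means and deviations; the zero mean of the process
  then fixes the two means.\<close>

lemma h_moments:
  assumes n: "n < N"
  shows "integrable M (\<lambda>\<omega>. cmod (h n t \<omega>) ^ 8)" "integrable M (h n t)"
    "expectation (\<lambda>\<omega>. cmod (h n t \<omega>) ^ 8) \<le> 840 * (expectation (\<lambda>\<omega>. (cmod (h n t \<omega>))\<^sup>2)) ^ 4"
proof -
  note [measurable] = h_measurable[OF n]
  have mR: "random_variable borel (\<lambda>\<omega>. Re (h n t \<omega>))" and mI: "random_variable borel (\<lambda>\<omega>. Im (h n t \<omega>))"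
    by measurable
  have G: "\<exists>\<mu> \<sigma>. 0 \<le> \<sigma> \<and> distr M borel (\<lambda>\<omega>. \<Sum>s\<in>{t}. u s * Re (h n s \<omega>) + v s * Im (h n s \<omega>)) = normal_law \<mu> \<sigma>"
    for u v using h_gaussian[OF n] unfolding gaussian_process_def by blast
  obtain \<mu> s where R: "0 \<le> s" "distr M borel (\<lambda>\<omega>. Re (h n t \<omega>)) = normal_law \<mu> s"
    using G[of "\<lambda>_. 1" "\<lambda>_. 0"] by auto
  obtain \<nu> s' where I: "0 \<le> s'" "distr M borel (\<lambda>\<omega>. Im (h n t \<omega>)) = normal_law \<nu> s'"
    using G[of "\<lambda>_. 0" "\<lambda>_. 1"] by auto
  note NR = normal_rv_mean[OF mR R(2,1)] and NI = normal_rv_mean[OF mI I(2,1)]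
  \<comment> \<open>\<open>h_mean\<close> is informative only once \<open>h n t\<close> is known to
    be integrable, because the integral of a non-integrable function is 0 by convention.\<close>
  have "integrable M (\<lambda>\<omega>. complex_of_real (Re (h n t \<omega>)) + \<i> * complex_of_real (Im (h n t \<omega>)))"
    using NR NI by (intro Bochner_Integration.integrable_add integrable_mult_right) auto
  then have ih: "integrable M (h n t)" by (simp add: complex_eq[symmetric])
  have "\<mu> = 0" "\<nu> = 0"
    using h_mean[OF n, of t] NR(2) NI(2) ih by (simp_all add: complex_eq_iff)
  note Z = complex_gaussian_moments[OF h_measurable[OF n, of t] _ R(1) _ I(1)]
  show "integrable M (\<lambda>\<omega>. cmod (h n t \<omega>) ^ 8)" "integrable M (h n t)"
    "expectation (\<lambda>\<omega>. cmod (h n t \<omega>) ^ 8) \<le> 840 * (expectation (\<lambda>\<omega>. (cmod (h n t \<omega>))\<^sup>2)) ^ 4"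
    using Z R(2) I(2) \<open>\<mu> = 0\<close> \<open>\<nu> = 0\<close> by auto
qed

lemma w_moments:
  assumes "n < N" "0 \<le> t" "t < int T"
  shows "integrable M (\<lambda>\<omega>. cmod (w n t \<omega>) ^ 8)" "expectation (\<lambda>\<omega>. (cmod (w n t \<omega>))\<^sup>2) = \<sigma>\<^sub>w\<^sup>2"
    "expectation (\<lambda>\<omega>. cmod (w n t \<omega>) ^ 8) \<le> 840 * \<sigma>\<^sub>w ^ 8"
    "integrable M (w n t)" "expectation (w n t) = 0"
  by (rule complex_normal_moments[OF w_measurable[OF assms] w_law[OF assms]])+

lemma x_moments:
  assumes "n < N"
  shows "integrable M (\<lambda>\<omega>. cmod (x n t \<omega>) ^ 8)" "expectation (\<lambda>\<omega>. (cmod (x n t \<omega>))\<^sup>2) = \<sigma>\<^sub>x\<^sup>2"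
    "integrable M (x n t)" "expectation (x n t) = 0"
  by (rule complex_normal_moments[OF x_measurable[OF assms] x_law[OF assms]])+

lemma h_square_integrable: "n < N \<Longrightarrow> integrable M (\<lambda>\<omega>. (cmod (h n t \<omega>))\<^sup>2)"
  by (rule integrable_norm_power2_of_power8[OF h_measurable h_moments(1)])

lemma w_square_integrable:
  "n < N \<Longrightarrow> 0 \<le> t \<Longrightarrow> t < int T \<Longrightarrow> integrable M (\<lambda>\<omega>. (cmod (w n t \<omega>))\<^sup>2)"
  by (rule integrable_norm_power2_of_power8[OF w_measurable w_moments(1)])

lemma x_square_integrable: "n < N \<Longrightarrow> integrable M (\<lambda>\<omega>. (cmod (x n t \<omega>))\<^sup>2)"
  by (rule integrable_norm_power2_of_power8[OF x_measurable x_moments(1)])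

section \<open>Orthogonality and the covariance of the observations\<close>

lemma innovation_orthogonal_past:
  assumes n: "n < N" and s: "s < t"
  shows "expectation (\<lambda>\<omega>. x n t \<omega> * cnj (h n s \<omega>)) = 0"
proof -
  \<comment> \<open>The model states independence for families indexed by sets of times; projecting
    each to one coordinate, and conjugating the second, leaves the two variables wanted.\<close>
  have "indep_var borel ((\<lambda>f. f t) \<circ> (\<lambda>\<omega>. \<lambda>s\<in>{t}. x n s \<omega>))
      borel ((\<lambda>f. cnj (f s)) \<circ> (\<lambda>\<omega>. \<lambda>s\<in>{..<t}. h n s \<omega>))"
    using s by (intro indep_var_compose[OF x_indep_past[OF n]] borel_measurable_cnj
        measurable_component_singleton) auto
  then have "indep_var borel (x n t) borel (\<lambda>\<omega>. cnj (h n s \<omega>))"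
    using s by (simp add: o_def)
  then have "expectation (\<lambda>\<omega>. x n t \<omega> * cnj (h n s \<omega>)) =
      expectation (x n t) * expectation (\<lambda>\<omega>. cnj (h n s \<omega>))"
    by (rule indep_var_lebesgue_integral) (use h_moments(2)[OF n] x_moments(3)[OF n] in auto)
  then show ?thesis using x_moments(4)[OF n] by simp
qed

lemma noise_orthogonal_signal:
  assumes n: "n < N" and t: "0 \<le> t" "t < int T"
  shows "expectation (\<lambda>\<omega>. w n t \<omega> * cnj (h n s \<omega>)) = 0"
    and "expectation (\<lambda>\<omega>. h n s \<omega> * cnj (w n t \<omega>)) = 0"
proof -
  have "indep_var borel ((\<lambda>f. f (n, t)) \<circ> (\<lambda>\<omega>. \<lambda>(n, t)\<in>{..<N} \<times> {0..<int T}. w n t \<omega>))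
      borel ((\<lambda>f. cnj (f (n, s))) \<circ> (\<lambda>\<omega>. \<lambda>(n, t)\<in>{..<N} \<times> UNIV. h n t \<omega>))"
    using n t by (intro indep_var_compose[OF w_indep_h] borel_measurable_cnj
        measurable_component_singleton) auto
  then have "indep_var borel (w n t) borel (\<lambda>\<omega>. cnj (h n s \<omega>))"
    using n t by (simp add: o_def)
  then have "expectation (\<lambda>\<omega>. w n t \<omega> * cnj (h n s \<omega>)) =
      expectation (w n t) * expectation (\<lambda>\<omega>. cnj (h n s \<omega>))"
    by (rule indep_var_lebesgue_integral) (use h_moments(2)[OF n] w_moments(4)[OF n t] in auto)
  then show *: "expectation (\<lambda>\<omega>. w n t \<omega> * cnj (h n s \<omega>)) = 0"
    using w_moments(5)[OF n t] by simp
  have "expectation (\<lambda>\<omega>. h n s \<omega> * cnj (w n t \<omega>)) =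
      cnj (expectation (\<lambda>\<omega>. w n t \<omega> * cnj (h n s \<omega>)))"
    by (simp add: Bochner_Integration.integral_cnj[symmetric] mult.commute del: Bochner_Integration.integral_cnj)
  also have "\<dots> = 0" unfolding * by simp
  finally show "expectation (\<lambda>\<omega>. h n s \<omega> * cnj (w n t \<omega>)) = 0" .
qed

lemma noise_covariance:
  assumes n: "n < N" and t: "0 \<le> t" "t < int T" and s: "0 \<le> s" "s < int T"
  shows "expectation (\<lambda>\<omega>. w n t \<omega> * cnj (w n s \<omega>)) = (if t = s then of_real (\<sigma>\<^sub>w\<^sup>2) else 0)"
proof (cases "t = s")
  case True
  have "expectation (\<lambda>\<omega>. w n t \<omega> * cnj (w n t \<omega>)) = of_real (\<sigma>\<^sub>w\<^sup>2)"
    by (simp only: complex_norm_square[symmetric] integral_complex_of_real w_moments(2)[OF n t])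
  then show ?thesis using True by simp
next
  case False
  \<comment> \<open>Restricting the noise family to two disjoint singletons gives independence of
    the pair.\<close>
  have "indep_var borel ((\<lambda>f. f (n, t)) \<circ> (\<lambda>\<omega>. \<lambda>i\<in>{(n, t)}. (case i of (n, t) \<Rightarrow> w n t) \<omega>))
      borel ((\<lambda>f. cnj (f (n, s))) \<circ> (\<lambda>\<omega>. \<lambda>i\<in>{(n, s)}. (case i of (n, t) \<Rightarrow> w n t) \<omega>))"
    using n t s False by (intro indep_var_compose[OF indep_var_restrict[OF w_indep]] borel_measurable_cnj
        measurable_component_singleton) auto
  then have "indep_var borel (w n t) borel (\<lambda>\<omega>. cnj (w n s \<omega>))"
    by (simp add: o_def)
  then have "expectation (\<lambda>\<omega>. w n t \<omega> * cnj (w n s \<omega>)) =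
      expectation (w n t) * expectation (\<lambda>\<omega>. cnj (w n s \<omega>))"
    by (rule indep_var_lebesgue_integral) (use w_moments(4)[OF n] t s in auto)
  then show ?thesis using False w_moments(5)[OF n t] by simp
qed

text \<open>Of the four products the mixed ones have mean zero, and the pure noise term survives
  only on the diagonal. That is the bias which the last term of \<open>sample_cov_zero\<close>
  removes, and the reason why lag 0 alone is corrected.\<close>

lemma observation_covariance:
  assumes n: "n < N" and t: "0 \<le> t" "t < int T" and s: "0 \<le> s" "s < int T"
  shows "integrable M (\<lambda>\<omega>. (h n t \<omega> + w n t \<omega>) * cnj (h n s \<omega> + w n s \<omega>))"
    and "expectation (\<lambda>\<omega>. (h n t \<omega> + w n t \<omega>) * cnj (h n s \<omega> + w n s \<omega>)) =
      expectation (\<lambda>\<omega>. h n t \<omega> * cnj (h n s \<omega>)) + (if t = s then of_real (\<sigma>\<^sub>w\<^sup>2) else 0)"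
proof -
  note mh = h_measurable[OF n] and mw = w_measurable[OF n]
  note h2 = h_square_integrable[OF n] and w2 = w_square_integrable[OF n]
  have eq: "(\<lambda>\<omega>. (h n t \<omega> + w n t \<omega>) * cnj (h n s \<omega> + w n s \<omega>)) =
      (\<lambda>\<omega>. (h n t \<omega> * cnj (h n s \<omega>) + h n t \<omega> * cnj (w n s \<omega>)) +
        (w n t \<omega> * cnj (h n s \<omega>) + w n t \<omega> * cnj (w n s \<omega>)))"
    by (simp add: fun_eq_iff algebra_simps)
  have i: "integrable M (\<lambda>\<omega>. h n t \<omega> * cnj (h n s \<omega>))" "integrable M (\<lambda>\<omega>. h n t \<omega> * cnj (w n s \<omega>))"
      "integrable M (\<lambda>\<omega>. w n t \<omega> * cnj (h n s \<omega>))" "integrable M (\<lambda>\<omega>. w n t \<omega> * cnj (w n s \<omega>))"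
    using t s by (intro integrable_mult_cnj mh mw h2 w2; simp)+
  show "integrable M (\<lambda>\<omega>. (h n t \<omega> + w n t \<omega>) * cnj (h n s \<omega> + w n s \<omega>))"
    unfolding eq using i by (intro Bochner_Integration.integrable_add)
  show "expectation (\<lambda>\<omega>. (h n t \<omega> + w n t \<omega>) * cnj (h n s \<omega> + w n s \<omega>)) =
      expectation (\<lambda>\<omega>. h n t \<omega> * cnj (h n s \<omega>)) + (if t = s then of_real (\<sigma>\<^sub>w\<^sup>2) else 0)"
    unfolding eq using i noise_orthogonal_signal(1)[OF n t] noise_orthogonal_signal(2)[OF n s]
      noise_covariance[OF n t s] by simp
qed

lemma observation_eighth_moment:
  assumes n: "n < N" and t: "0 \<le> t" "t < int T"
  shows "integrable M (\<lambda>\<omega>. cmod (h n t \<omega> + w n t \<omega>) ^ 8)"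
    and "expectation (\<lambda>\<omega>. cmod (h n t \<omega> + w n t \<omega>) ^ 8) \<le>
      128 * (840 * (expectation (\<lambda>\<omega>. (cmod (h n t \<omega>))\<^sup>2)) ^ 4 + 840 * \<sigma>\<^sub>w ^ 8)"
proof -
  note [measurable] = h_measurable[OF n] w_measurable[OF n t]
  have i: "integrable M (\<lambda>\<omega>. 128 * (cmod (h n t \<omega>) ^ 8 + cmod (w n t \<omega>) ^ 8))"
    using h_moments(1)[OF n] w_moments(1)[OF n t] by simp
  have le: "cmod (u + v) ^ 8 \<le> 128 * (cmod u ^ 8 + cmod v ^ 8)" for u v
  proof -
    have "cmod (u + v) ^ 8 \<le> (cmod u + cmod v) ^ 8"
      by (intro power_mono norm_triangle_ineq) auto
    then show ?thesis using add_power8_le[of "cmod u" "cmod v"] by linarith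
  qed
  show i': "integrable M (\<lambda>\<omega>. cmod (h n t \<omega> + w n t \<omega>) ^ 8)"
    by (rule Bochner_Integration.integrable_bound[OF i]) (use le in \<open>auto simp: add_nonneg_nonneg\<close>)
  have "expectation (\<lambda>\<omega>. cmod (h n t \<omega> + w n t \<omega>) ^ 8) \<le>
      expectation (\<lambda>\<omega>. 128 * (cmod (h n t \<omega>) ^ 8 + cmod (w n t \<omega>) ^ 8))"
    by (intro integral_mono i i' le)
  also have "\<dots> \<le> 128 * (840 * (expectation (\<lambda>\<omega>. (cmod (h n t \<omega>))\<^sup>2)) ^ 4 + 840 * \<sigma>\<^sub>w ^ 8)"
    using h_moments[OF n, of t] w_moments[OF n t] by simp
  finally show "expectation (\<lambda>\<omega>. cmod (h n t \<omega> + w n t \<omega>) ^ 8) \<le>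
      128 * (840 * (expectation (\<lambda>\<omega>. (cmod (h n t \<omega>))\<^sup>2)) ^ 4 + 840 * \<sigma>\<^sub>w ^ 8)" .
qed

section \<open>Rows: lag products of one process averaged over time\<close>

text \<open>The divisor is \<open>T\<close> at every lag, not the number of products, so that the
  mean over rows is the biased estimate up to the innovation variance and the noise
  correction.\<close>

definition row_lag_mean :: "int \<Rightarrow> nat \<Rightarrow> 'a \<Rightarrow> complex" where
  "row_lag_mean k n \<omega> =
    (\<Sum>t | 0 \<le> t \<and> t \<le> int T - 1 \<and> 0 \<le> t + k \<and> t + k \<le> int T - 1.
      (h n (t + k) \<omega> + w n (t + k) \<omega>) * cnj (h n t \<omega> + w n t \<omega>)) / of_nat T"

text \<open>A row is a measurable function of the pair formed by the noise block with first index
  \<open>n\<close> and the whole path \<open>h n\<close>, and these pairs are independent for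
  different \<open>n\<close>.\<close>

lemma indep_row_lag_mean: "indep_vars (\<lambda>_. borel) (row_lag_mean k) {..<N}"
proof -
  let ?I = "{t. 0 \<le> t \<and> t \<le> int T - 1 \<and> 0 \<le> t + k \<and> t + k \<le> int T - 1}"
  let ?K = "\<lambda>n. {n} \<times> {0..<int T}"
  let ?W = "\<lambda>\<omega>. \<lambda>(n, t)\<in>{..<N} \<times> {0..<int T}. w n t \<omega>"
  let ?H = "\<lambda>\<omega>. \<lambda>(n, t)\<in>{..<N} \<times> UNIV. h n t \<omega>"
  let ?A = "\<lambda>n. Pi\<^sub>M (?K n) (\<lambda>_. borel :: complex measure)"
  let ?B = "Pi\<^sub>M (UNIV :: int set) (\<lambda>_. borel :: complex measure)"
  \<comment> \<open>Blocks with different first index are disjoint, so restricting the independent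
    noise variables to them gives independent families.\<close>
  have W: "indep_vars ?A (\<lambda>n \<omega>. restrict (?W \<omega>) (?K n)) {..<N}"
  proof -
    have "indep_vars ?A (\<lambda>n \<omega>. restrict (\<lambda>i. (case i of (n, t) \<Rightarrow> w n t) \<omega>) (?K n)) {..<N}"
      by (rule indep_vars_restrict[OF w_indep]) (auto simp: disjoint_family_on_def)
    then show ?thesis
      by (rule iffD1[OF indep_vars_cong, rotated -1]) (auto simp: fun_eq_iff restrict_def)
  qed
  have H: "indep_vars (\<lambda>_. ?B) (\<lambda>n \<omega> t. ?H \<omega> (n, t)) {..<N}"
    using h_indep by (rule iffD1[OF indep_vars_cong, rotated -1]) (auto simp: fun_eq_iff)
  have "indep_vars (\<lambda>n. ?A n \<Otimes>\<^sub>M ?B) (\<lambda>n \<omega>. (restrict (?W \<omega>) (?K n), \<lambda>t. ?H \<omega> (n, t))) {..<N}"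
  proof (rule indep_vars_Pair[where f = "\<lambda>n f. restrict f (?K n)" and g = "\<lambda>n f t. f (n, t)"
      and U = ?W and V = ?H, OF _ w_indep_h _ _ W H])
    show "(\<lambda>f. restrict f (?K n)) \<in> Pi\<^sub>M ({..<N} \<times> {0..<int T}) (\<lambda>_. borel) \<rightarrow>\<^sub>M ?A n"
      if "n \<in> {..<N}" for n
      using that by (intro measurable_restrict_subset) auto
    show "(\<lambda>f t. f (n, t)) \<in> Pi\<^sub>M ({..<N} \<times> UNIV) (\<lambda>_. borel) \<rightarrow>\<^sub>M ?B" if "n \<in> {..<N}" for n
      using that by (intro measurable_PiM_single' measurable_component_singleton) auto
  qed simp
  then have "indep_vars (\<lambda>_. borel) (\<lambda>n \<omega>. (\<lambda>(f, e). (\<Sum>t\<in>?I. (e (t + k) + f (n, t + k)) *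
      cnj (e t + f (n, t))) / of_nat T) (restrict (?W \<omega>) (?K n), \<lambda>t. ?H \<omega> (n, t))) {..<N}"
  proof (rule indep_vars_compose2)
    fix n assume "n \<in> {..<N}"
    \<comment> \<open>Noise coordinates exist only for times from 0 to T - 1; every time of the
      window lies there, and so does its shift by \<open>k\<close>.\<close>
    have f: "(\<lambda>q. fst q (n, t)) \<in> borel_measurable (?A n \<Otimes>\<^sub>M ?B)" if "0 \<le> t" "t \<le> int T - 1" for t
      using that by (intro measurable_compose[OF measurable_fst] measurable_component_singleton) auto
    have e: "(\<lambda>q. snd q t) \<in> borel_measurable (?A n \<Otimes>\<^sub>M ?B)" for t
      by (intro measurable_compose[OF measurable_snd] measurable_component_singleton) auto
    show "(\<lambda>(f, e). (\<Sum>t\<in>?I. (e (t + k) + f (n, t + k)) * cnj (e t + f (n, t))) / of_nat T)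
        \<in> borel_measurable (?A n \<Otimes>\<^sub>M ?B)"
      unfolding split_beta
      by (intro borel_measurable_divide borel_measurable_sum borel_measurable_times
          borel_measurable_add borel_measurable_cnj e f borel_measurable_const) auto
  qed
  then show ?thesis
    by (rule iffD1[OF indep_vars_cong, rotated -1])
       (auto simp: fun_eq_iff row_lag_mean_def intro!: arg_cong2[where f = "(/)"] sum.cong)
qed

lemma lag_window_eq:
  "{t. 0 \<le> t \<and> t \<le> int T - 1 \<and> 0 \<le> t + k \<and> t + k \<le> int T - 1} =
    {max 0 (- k)..<min (int T) (int T - k)}"
  by auto

text \<open>The window holds T - |k| times while the divisor is \<open>T\<close>; hence the factor.
  At |k| = T the window is empty and both sides are 0.\<close>

lemma expectation_row_lag_mean:
  assumes n: "n < N" and T: "\<bar>k\<bar> \<le> int T"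
    and cov: "\<And>t. expectation (\<lambda>\<omega>. h n t \<omega> * cnj (h n (t - k) \<omega>)) = \<gamma>"
  shows "expectation (row_lag_mean k n) =
    of_real ((real T - real_of_int \<bar>k\<bar>) / real T) * (\<gamma> + (if k = 0 then of_real (\<sigma>\<^sub>w\<^sup>2) else 0))"
proof -
  let ?I = "{t. 0 \<le> t \<and> t \<le> int T - 1 \<and> 0 \<le> t + k \<and> t + k \<le> int T - 1}"
  have card: "real (card ?I) = real T - real_of_int \<bar>k\<bar>"
    using T unfolding lag_window_eq by (simp add: max_def min_def)
  have "expectation (row_lag_mean k n) = (\<Sum>t\<in>?I.
      expectation (\<lambda>\<omega>. (h n (t + k) \<omega> + w n (t + k) \<omega>) * cnj (h n t \<omega> + w n t \<omega>))) / of_nat T"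
    unfolding row_lag_mean_def
    by (subst integral_divide_zero, subst Bochner_Integration.integral_sum)
       (auto intro!: observation_covariance(1) n simp del: complex_cnj_add)
  also have "(\<Sum>t\<in>?I. expectation (\<lambda>\<omega>. (h n (t + k) \<omega> + w n (t + k) \<omega>) * cnj (h n t \<omega> + w n t \<omega>))) =
      (\<Sum>t\<in>?I. \<gamma> + (if k = 0 then of_real (\<sigma>\<^sub>w\<^sup>2) else 0))"
  proof (rule sum.cong)
    fix t assume "t \<in> ?I"
    \<comment> \<open>The times t + k and t coincide exactly when k = 0, which is where the noise
      variance appears.\<close>
    then show "expectation (\<lambda>\<omega>. (h n (t + k) \<omega> + w n (t + k) \<omega>) * cnj (h n t \<omega> + w n t \<omega>)) =
        \<gamma> + (if k = 0 then of_real (\<sigma>\<^sub>w\<^sup>2) else 0)"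
      using cov[of "t + k"] by (subst observation_covariance(2)[OF n]) auto
  qed simp
  also have "\<dots> = of_nat (card ?I) * (\<gamma> + (if k = 0 then of_real (\<sigma>\<^sub>w\<^sup>2) else 0))" by simp
  also have "of_nat (card ?I) = complex_of_real (real T - real_of_int \<bar>k\<bar>)"
    unfolding card[symmetric] by simp
  finally show ?thesis by simp
qed

text \<open>The power mean inequality over the window and (uz)^4 <= (u^8 + z^8)/2 dominate the
  fourth power by eighth powers summed over time. The remaining factor T^3/T^4 turns the sum into an
  average, so the bound depends neither on \<open>T\<close> nor on \<open>k\<close>.\<close>

lemma row_lag_mean_fourth_moment:
  assumes n: "n < N" and pos: "1 \<le> T"
    and var: "\<And>t. expectation (\<lambda>\<omega>. (cmod (h n t \<omega>))\<^sup>2) = v"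
  shows "integrable M (\<lambda>\<omega>. cmod (row_lag_mean k n \<omega>) ^ 4)"
    and "expectation (\<lambda>\<omega>. cmod (row_lag_mean k n \<omega>) ^ 4) \<le> 128 * (840 * v ^ 4 + 840 * \<sigma>\<^sub>w ^ 8)"
proof -
  let ?I = "{t. 0 \<le> t \<and> t \<le> int T - 1 \<and> 0 \<le> t + k \<and> t + k \<le> int T - 1}"
  define g where "g t \<omega> = h n t \<omega> + w n t \<omega>" for t \<omega>
  define B where "B = 128 * (840 * v ^ 4 + 840 * \<sigma>\<^sub>w ^ 8)"
  have g8: "integrable M (\<lambda>\<omega>. cmod (g t \<omega>) ^ 8)" "expectation (\<lambda>\<omega>. cmod (g t \<omega>) ^ 8) \<le> B"
    if "0 \<le> t" "t \<le> int T - 1" for t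
    using observation_eighth_moment[OF n, of t] that by (simp_all add: g_def var B_def)
  have B: "0 \<le> B" by (simp add: B_def)
  have fin: "finite ?I" unfolding lag_window_eq by simp
  have card: "real (card ?I) \<le> real T"
  proof -
    have "card ?I \<le> card {0..<int T}" by (intro card_mono) auto
    then show ?thesis by simp
  qed
  define D where "D \<omega> = (\<Sum>t\<in>?I. (cmod (g (t + k) \<omega>) ^ 8 + cmod (g t \<omega>) ^ 8) / 2) / real T" for \<omega>
  have le: "cmod (row_lag_mean k n \<omega>) ^ 4 \<le> D \<omega>" for \<omega>
  proof -
    have "cmod (row_lag_mean k n \<omega>) \<le> (\<Sum>t\<in>?I. cmod (g (t + k) \<omega>) * cmod (g t \<omega>)) / real T"
      unfolding row_lag_mean_def g_def[symmetric] norm_divide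
      by (auto intro!: divide_right_mono order_trans[OF norm_sum] simp: norm_mult)
    then have "cmod (row_lag_mean k n \<omega>) ^ 4 \<le>
        ((\<Sum>t\<in>?I. cmod (g (t + k) \<omega>) * cmod (g t \<omega>)) / real T) ^ 4"
      by (intro power_mono) auto
    also have "\<dots> = (\<Sum>t\<in>?I. cmod (g (t + k) \<omega>) * cmod (g t \<omega>)) ^ 4 / real T ^ 4"
      by (simp add: power_divide)
    also have "\<dots> \<le> (real (card ?I) ^ 3 * (\<Sum>t\<in>?I. (cmod (g (t + k) \<omega>) * cmod (g t \<omega>)) ^ 4)) / real T ^ 4"
      by (intro divide_right_mono sum_fourth_power_le) auto
    also have "\<dots> \<le> (real T ^ 3 * (\<Sum>t\<in>?I. (cmod (g (t + k) \<omega>) ^ 8 + cmod (g t \<omega>) ^ 8) / 2)) / real T ^ 4"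
    proof (intro divide_right_mono mult_mono sum_mono)
      fix t
      have "2 * (u ^ 4 * z ^ 4) \<le> u ^ 8 + z ^ 8" for u z :: real
        using sum_squares_bound[of "u ^ 4" "z ^ 4"] by simp
      from this[of "cmod (g (t + k) \<omega>)" "cmod (g t \<omega>)"]
      show "(cmod (g (t + k) \<omega>) * cmod (g t \<omega>)) ^ 4 \<le> (cmod (g (t + k) \<omega>) ^ 8 + cmod (g t \<omega>) ^ 8) / 2"
        by (simp add: power_mult_distrib)
    qed (use card in \<open>auto intro!: power_mono sum_nonneg\<close>)
    also have "\<dots> = D \<omega>"
      unfolding D_def using pos by (simp add: power4_eq_xxxx power3_eq_cube)
    finally show ?thesis .
  qed
  have iD: "integrable M D"
    unfolding D_def
    by (intro integrable_divide_zero Bochner_Integration.integrable_sum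
        Bochner_Integration.integrable_add g8) auto
  have "random_variable borel (row_lag_mean k n)"
    using indep_row_lag_mean[of k] n by (auto simp: indep_vars_def)
  then show i: "integrable M (\<lambda>\<omega>. cmod (row_lag_mean k n \<omega>) ^ 4)"
    using le order_trans[OF _ abs_ge_self]
    by (intro Bochner_Integration.integrable_bound[OF iD]) auto
  have "expectation (\<lambda>\<omega>. cmod (row_lag_mean k n \<omega>) ^ 4) \<le> expectation D"
    by (intro integral_mono i iD le)
  also have "\<dots> = (\<Sum>t\<in>?I. (expectation (\<lambda>\<omega>. cmod (g (t + k) \<omega>) ^ 8) +
      expectation (\<lambda>\<omega>. cmod (g t \<omega>) ^ 8)) / 2) / real T"
    unfolding D_def
    by (subst integral_divide_zero, subst Bochner_Integration.integral_sum) (auto intro!: g8 simp: g8)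
  also have "\<dots> \<le> (\<Sum>t\<in>?I. B) / real T"
  proof (intro divide_right_mono sum_mono)
    fix t assume "t \<in> ?I"
    then show "(expectation (\<lambda>\<omega>. cmod (g (t + k) \<omega>) ^ 8) + expectation (\<lambda>\<omega>. cmod (g t \<omega>) ^ 8)) / 2 \<le> B"
      using g8(2)[of t] g8(2)[of "t + k"] by simp
  qed simp
  also have "\<dots> \<le> B"
    using mult_right_mono[OF card B] pos by (simp add: divide_le_eq mult.commute)
  finally show "expectation (\<lambda>\<omega>. cmod (row_lag_mean k n \<omega>) ^ 4) \<le> 128 * (840 * v ^ 4 + 840 * \<sigma>\<^sub>w ^ 8)"
    by (simp add: B_def)
qed

section \<open>The limiting Yule-Walker system\<close>

lemma yule_walker_equation:
  assumes n: "n < N" and \<sigma>: "\<sigma>\<^sub>x \<noteq> 0"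
    and cov: "\<And>t k. expectation (\<lambda>\<omega>. h n t \<omega> * cnj (h n (t - k) \<omega>)) = of_real (\<sigma>\<^sub>x\<^sup>2) * r k"
    and k: "1 \<le> k"
  shows "r k = (\<Sum>i = 1..p. of_real (a i) * r (k - int i))"
proof -
  note mh = h_measurable[OF n] and mx = x_measurable[OF n]
  have i: "integrable M (\<lambda>\<omega>. h n s \<omega> * cnj (h n t \<omega>))" "integrable M (\<lambda>\<omega>. x n s \<omega> * cnj (h n t \<omega>))" for s t
    by (intro integrable_mult_cnj mh mx h_square_integrable x_square_integrable n)+
  \<comment> \<open>The AR equation at time 0 is multiplied by the conjugate of h(-k) and
    integrated; by \<open>cov\<close> every term depends on its lag only.\<close>
  have "expectation (\<lambda>\<omega>. h n 0 \<omega> * cnj (h n (0 - k) \<omega>)) =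
      expectation (\<lambda>\<omega>. (\<Sum>i = 1..p. of_real (a i) * (h n (0 - int i) \<omega> * cnj (h n (- k) \<omega>))) +
        x n 0 \<omega> * cnj (h n (- k) \<omega>))"
  proof (rule integral_cong_AE)
    show "AE \<omega> in M. h n 0 \<omega> * cnj (h n (0 - k) \<omega>) =
        (\<Sum>i = 1..p. of_real (a i) * (h n (0 - int i) \<omega> * cnj (h n (- k) \<omega>))) + x n 0 \<omega> * cnj (h n (- k) \<omega>)"
      using ar_equation[OF n, of 0]
    proof eventually_elim
      case (elim \<omega>)
      show ?case by (subst elim) (simp add: distrib_right sum_distrib_right mult.assoc)
    qed
  qed (use mh mx in measurable)
  also have "\<dots> = (\<Sum>i = 1..p. of_real (a i) * expectation (\<lambda>\<omega>. h n (0 - int i) \<omega> * cnj (h n (- k) \<omega>))) +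
      expectation (\<lambda>\<omega>. x n 0 \<omega> * cnj (h n (- k) \<omega>))"
    by (subst Bochner_Integration.integral_add)
       (auto intro!: Bochner_Integration.integrable_sum integrable_mult_right i simp: Bochner_Integration.integral_sum i)
  \<comment> \<open>For k >= 1 the time -k lies strictly before 0, so the innovation term drops
    out.\<close>
  also have "expectation (\<lambda>\<omega>. x n 0 \<omega> * cnj (h n (- k) \<omega>)) = 0"
    by (rule innovation_orthogonal_past[OF n]) (use k in simp)
  also have "(\<Sum>i = 1..p. of_real (a i) * expectation (\<lambda>\<omega>. h n (0 - int i) \<omega> * cnj (h n (- k) \<omega>))) =
      (\<Sum>i = 1..p. of_real (a i) * (of_real (\<sigma>\<^sub>x\<^sup>2) * r (k - int i)))"
  proof (rule sum.cong)
    fix i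
    show "of_real (a i) * expectation (\<lambda>\<omega>. h n (0 - int i) \<omega> * cnj (h n (- k) \<omega>)) =
        of_real (a i) * (of_real (\<sigma>\<^sub>x\<^sup>2) * r (k - int i))"
      using cov[of "0 - int i" "k - int i"] by simp
  qed simp
  finally have "of_real (\<sigma>\<^sub>x\<^sup>2) * r k = of_real (\<sigma>\<^sub>x\<^sup>2) * (\<Sum>i = 1..p. of_real (a i) * r (k - int i))"
    unfolding cov by (simp add: sum_distrib_left mult.left_commute)
  then show ?thesis using \<sigma> by simp
qed

text \<open>The Toeplitz matrix times the innovation variance is the Gram matrix of h(0), ...,
  h(m-1). The sum over \<open>j\<close> is kept as an inner factor because a kernel vector
  annihilates it for each \<open>i\<close>.\<close>

lemma expectation_norm_square_combination:
  assumes n: "n < N"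
    and cov: "\<And>t k. expectation (\<lambda>\<omega>. h n t \<omega> * cnj (h n (t - k) \<omega>)) = of_real (\<sigma>\<^sub>x\<^sup>2) * r k"
  shows "expectation (\<lambda>\<omega>. (\<Sum>i<m. b i * h n (int i) \<omega>) * cnj (\<Sum>j<m. b j * h n (int j) \<omega>)) =
    of_real (\<sigma>\<^sub>x\<^sup>2) * (\<Sum>i<m. b i * (\<Sum>j<m. r (int i - int j) * cnj (b j)))"
proof -
  note mh = h_measurable[OF n]
  have i: "integrable M (\<lambda>\<omega>. h n s \<omega> * cnj (h n t \<omega>))" for s t
    by (intro integrable_mult_cnj mh h_square_integrable n)
  have "(\<lambda>\<omega>. (\<Sum>i<m. b i * h n (int i) \<omega>) * cnj (\<Sum>j<m. b j * h n (int j) \<omega>)) =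
      (\<lambda>\<omega>. \<Sum>i<m. \<Sum>j<m. b i * cnj (b j) * (h n (int i) \<omega> * cnj (h n (int j) \<omega>)))"
    by (simp add: fun_eq_iff sum_product cnj_sum mult_ac)
  then have "expectation (\<lambda>\<omega>. (\<Sum>i<m. b i * h n (int i) \<omega>) * cnj (\<Sum>j<m. b j * h n (int j) \<omega>)) =
      (\<Sum>i<m. \<Sum>j<m. b i * cnj (b j) * expectation (\<lambda>\<omega>. h n (int i) \<omega> * cnj (h n (int j) \<omega>)))"
    using i by (simp add: Bochner_Integration.integral_sum Bochner_Integration.integrable_sum)
  also have "\<dots> = (\<Sum>i<m. \<Sum>j<m. b i * cnj (b j) * (of_real (\<sigma>\<^sub>x\<^sup>2) * r (int i - int j)))"
  proof -
    have "expectation (\<lambda>\<omega>. h n (int i) \<omega> * cnj (h n (int j) \<omega>)) = of_real (\<sigma>\<^sub>x\<^sup>2) * r (int i - int j)" for i j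
      using cov[of "int i" "int i - int j"] by simp
    then show ?thesis by simp
  qed
  finally show ?thesis by (simp add: sum_distrib_left mult_ac)
qed

lemma toeplitz_nonsingular:
  assumes n: "n < N" and \<sigma>: "\<sigma>\<^sub>x \<noteq> 0"
    and cov: "\<And>t k. expectation (\<lambda>\<omega>. h n t \<omega> * cnj (h n (t - k) \<omega>)) = of_real (\<sigma>\<^sub>x\<^sup>2) * r k"
  shows "Determinant.det (toeplitz q r) \<noteq> 0"
proof
  assume "Determinant.det (toeplitz q r) = 0"
  then obtain v where v: "v \<in> carrier_vec q" "v \<noteq> 0\<^sub>v q" "toeplitz q r *\<^sub>v v = 0\<^sub>v q"
    using det_0_iff_vec_prod_zero[OF toeplitz_carrier] by blast
  note [measurable] = h_measurable[OF n] x_measurable[OF n]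
  \<comment> \<open>The Gram form conjugates the coefficients in its inner sum; starting from the
    conjugate of \<open>v\<close> makes that sum a row of \<open>toeplitz q r\<close> applied to
    \<open>v\<close>.\<close>
  define b where "b i = cnj (vec_index v i)" for i
  have kernel: "(\<Sum>j<q. r (int i - int j) * cnj (b j)) = 0" if "i < q" for i
  proof -
    have "vec_index (toeplitz q r *\<^sub>v v) i = (\<Sum>j<q. r (int i - int j) * vec_index v j)"
      using that v(1) by (simp add: toeplitz_def scalar_prod_def lessThan_atLeast0)
    then show ?thesis using v(3) that by (simp add: b_def)
  qed
  define Z where "Z \<omega> = (\<Sum>i<q. b i * h n (int i) \<omega>)" for \<omega>
  have mZ [measurable]: "random_variable borel Z" unfolding Z_def by measurable
  have "expectation (\<lambda>\<omega>. Z \<omega> * cnj (Z \<omega>)) = 0"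
    unfolding Z_def expectation_norm_square_combination[OF n cov] by (simp add: kernel)
  then have Z0: "expectation (\<lambda>\<omega>. (cmod (Z \<omega>))\<^sup>2) = 0"
    by (simp only: complex_norm_square[symmetric] integral_complex_of_real of_real_eq_0_iff)
  have ihh: "integrable M (\<lambda>\<omega>. h n s \<omega> * cnj (h n t \<omega>))" for s t
    by (intro integrable_mult_cnj h_measurable h_square_integrable n)
  have ixh: "integrable M (\<lambda>\<omega>. x n s \<omega> * cnj (h n t \<omega>))" for s t
    by (intro integrable_mult_cnj h_measurable h_square_integrable x_measurable x_square_integrable n)
  have "integrable M (\<lambda>\<omega>. Z \<omega> * cnj (Z \<omega>))"
    unfolding Z_def cnj_sum sum_product complex_cnj_mult
    using ihh by (auto intro!: Bochner_Integration.integrable_sum simp: mult_ac)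
  then have "integrable M (\<lambda>\<omega>. (cmod (Z \<omega>))\<^sup>2)"
    by (simp only: complex_norm_square[symmetric] complex_of_real_integrable_eq)
  then have "AE \<omega> in M. (cmod (Z \<omega>))\<^sup>2 = 0"
    using Z0 by (subst (asm) integral_nonneg_eq_0_iff_AE) auto
  then have AEZ: "AE \<omega> in M. Z \<omega> = 0" by eventually_elim simp
  obtain i where "i < q" "b i \<noteq> 0"
    using v(1,2) by (auto simp: b_def vec_eq_iff)
  then have ne: "{i. i < q \<and> b i \<noteq> 0} \<noteq> {}" by auto
  \<comment> \<open>The last nonzero coefficient: dividing by \<open>b m\<close> expresses h(m)
    through h(0), ..., h(m-1), all strictly before time \<open>m\<close>.\<close>
  define m where "m = Max {i. i < q \<and> b i \<noteq> 0}"
  have "m \<in> {i. i < q \<and> b i \<noteq> 0}" unfolding m_def by (rule Max_in) (use ne in auto)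
  then have m: "m < q" "b m \<noteq> 0" by auto
  have above: "b i = 0" if "i < q" "m < i" for i
  proof (rule ccontr)
    assume "b i \<noteq> 0"
    then have "i \<le> m" unfolding m_def using that by (intro Max_ge) auto
    then show False using that by simp
  qed
  have Zm: "Z \<omega> = (\<Sum>i<m. b i * h n (int i) \<omega>) + b m * h n (int m) \<omega>" for \<omega>
  proof -
    have "Z \<omega> = (\<Sum>i<Suc m. b i * h n (int i) \<omega>)"
      unfolding Z_def using m above by (intro sum.mono_neutral_right) auto
    then show ?thesis by simp
  qed
  let ?L = "\<lambda>\<omega>. (\<Sum>i<m. cnj (- b i / b m) * cnj (h n (int i) \<omega>)) +
      (\<Sum>i = 1..p. - of_real (a i) * cnj (h n (int m - int i) \<omega>))"
  \<comment> \<open>The vanishing combination and the AR equation give two expressions for h(m);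
    comparing them isolates x(m). The conjugate is taken because the orthogonality relations pair an
    innovation with a conjugated value of \<open>h\<close>.\<close>
  have AEx: "AE \<omega> in M. cnj (x n (int m) \<omega>) = ?L \<omega>"
    using AEZ ar_equation[OF n, of "int m"]
  proof eventually_elim
    case (elim \<omega>)
    have "h n (int m) \<omega> = - (\<Sum>i<m. b i * h n (int i) \<omega>) / b m"
      using elim(1) m(2) unfolding Zm by (simp add: field_simps eq_neg_iff_add_eq_0 add.commute)
    also have "\<dots> = (\<Sum>i<m. (- b i / b m) * h n (int i) \<omega>)"
      by (simp add: sum_divide_distrib sum_negf)
    finally have "x n (int m) \<omega> = (\<Sum>i<m. (- b i / b m) * h n (int i) \<omega>) -
        (\<Sum>i = 1..p. of_real (a i) * h n (int m - int i) \<omega>)"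
      using elim(2) by (simp add: algebra_simps)
    then have "cnj (x n (int m) \<omega>) = cnj ((\<Sum>i<m. (- b i / b m) * h n (int i) \<omega>) -
        (\<Sum>i = 1..p. of_real (a i) * h n (int m - int i) \<omega>))" by simp
    also have "\<dots> = ?L \<omega>" by (simp add: cnj_sum sum_negf)
    finally show ?case .
  qed
  \<comment> \<open>Every term on the right pairs x(m) with a value of \<open>h\<close> before time
    \<open>m\<close>, so x(m) has second moment 0, against its positive variance.\<close>
  have "expectation (\<lambda>\<omega>. x n (int m) \<omega> * cnj (x n (int m) \<omega>)) =
      expectation (\<lambda>\<omega>. (\<Sum>i<m. cnj (- b i / b m) * (x n (int m) \<omega> * cnj (h n (int i) \<omega>))) +
        (\<Sum>i = 1..p. - of_real (a i) * (x n (int m) \<omega> * cnj (h n (int m - int i) \<omega>))))"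
  proof (rule integral_cong_AE)
    show "AE \<omega> in M. x n (int m) \<omega> * cnj (x n (int m) \<omega>) =
        (\<Sum>i<m. cnj (- b i / b m) * (x n (int m) \<omega> * cnj (h n (int i) \<omega>))) +
        (\<Sum>i = 1..p. - of_real (a i) * (x n (int m) \<omega> * cnj (h n (int m - int i) \<omega>)))"
      using AEx
    proof eventually_elim
      case (elim \<omega>)
      show ?case unfolding elim by (simp only: distrib_left sum_distrib_left mult.left_commute)
    qed
  qed measurable
  also have "\<dots> = (\<Sum>i<m. cnj (- b i / b m) * expectation (\<lambda>\<omega>. x n (int m) \<omega> * cnj (h n (int i) \<omega>))) +
      (\<Sum>i = 1..p. - of_real (a i) * expectation (\<lambda>\<omega>. x n (int m) \<omega> * cnj (h n (int m - int i) \<omega>)))"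
    by (subst Bochner_Integration.integral_add)
       (auto intro!: Bochner_Integration.integrable_sum integrable_mult_right ixh
         simp: Bochner_Integration.integral_sum ixh simp del: mult_minus_left)
  also have "\<dots> = 0"
    using innovation_orthogonal_past[OF n] by simp
  finally have "of_real (\<sigma>\<^sub>x\<^sup>2) = (0 :: complex)"
    by (simp only: complex_norm_square[symmetric] integral_complex_of_real x_moments(2)[OF n])
  then show False using \<sigma> by simp
qed

section \<open>The estimates expressed through rows\<close>

lemma lag_product_sum_eq_row_lag_mean:
  "1 \<le> T \<Longrightarrow> lag_product_sum N T (\<lambda>n t. h n t \<omega> + w n t \<omega>) k / of_nat T = (\<Sum>n<N. row_lag_mean k n \<omega>)"
  by (simp add: lag_product_sum_def row_lag_mean_def sum_divide_distrib)

end

text \<open>At lag 0 the squared moduli are themselves lag products, since |z|^2 is z times its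
  conjugate. Both branches of the definition thus share one formula, in which only the noise
  correction depends on the lag being 0.\<close>

lemma biased_cov_eq:
  assumes "\<sigma>\<^sub>x \<noteq> 0"
  shows "biased_cov \<sigma>\<^sub>x \<sigma>\<^sub>w N T g k =
    (lag_product_sum N T g k / of_nat T / of_nat N - (if k = 0 then of_real (\<sigma>\<^sub>w\<^sup>2) else 0)) / of_real (\<sigma>\<^sub>x\<^sup>2)"
proof (cases "k = 0")
  case True
  have "lag_product_sum N T g 0 = of_real (\<Sum>n<N. \<Sum>t=0..int T - 1. (cmod (g n t))\<^sup>2)"
    unfolding lag_product_sum_def of_real_sum complex_norm_square by (intro sum.cong) auto
  then show ?thesis using True assms
    by (simp add: biased_cov_def sample_cov_zero_def diff_divide_distrib mult_ac)
next
  case False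
  then show ?thesis by (simp add: biased_cov_def mult_ac)
qed

lemma unbiased_cov_eq_biased_cov:
  assumes "\<bar>k\<bar> < int T"
  shows "unbiased_cov \<sigma>\<^sub>x \<sigma>\<^sub>w N T g k =
    (if k = 0 then 1 else of_real (real T / (real T - \<bar>real_of_int k\<bar>))) * biased_cov \<sigma>\<^sub>x \<sigma>\<^sub>w N T g k"
proof (cases "k = 0")
  case False
  have "T > 0" using assms by linarith
  then show ?thesis using False by (simp add: biased_cov_def unbiased_cov_def)
qed (simp add: biased_cov_def unbiased_cov_def)

section \<open>Consistency\<close>

theorem mainTheorem2:
  fixes M :: "'a measure"
    and p :: nat and a :: "nat \<Rightarrow> real" and \<sigma>\<^sub>x \<sigma>\<^sub>w K c :: real
    and N\<^sub>r :: "nat \<Rightarrow> nat"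
    and h x w :: "nat \<Rightarrow> nat \<Rightarrow> int \<Rightarrow> 'a \<Rightarrow> complex"
    and obs :: "nat \<Rightarrow> 'a \<Rightarrow> nat \<Rightarrow> int \<Rightarrow> complex"
    and r :: "int \<Rightarrow> complex"
  assumes order: "1 \<le> p"
    and variances: "0 < \<sigma>\<^sub>x" "0 \<le> \<sigma>\<^sub>w"
    and model: "\<And>T. 1 \<le> T \<Longrightarrow>
          ar_observation_model M p a \<sigma>\<^sub>x \<sigma>\<^sub>w (N\<^sub>r T) T (h T) (x T) (w T)"
    and obs: "\<And>T \<omega> n t. obs T \<omega> n t = h T n t \<omega> + w T n t \<omega>"
    and r: "\<And>T n t k. 1 \<le> T \<Longrightarrow> n < N\<^sub>r T \<Longrightarrow>
          r k = (LINT \<omega>|M. h T n t \<omega> * cnj (h T n (t - k) \<omega>)) / of_real (\<sigma>\<^sub>x\<^sup>2)"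
    and r_summable: "\<And>T::nat. 1 \<le> T \<Longrightarrow> (\<Sum>k=1 - int T..int T - 1. cmod (r k)) \<le> K"
    and c_pos: "0 < c"
    and regime: "(\<lambda>T. real (N\<^sub>r T) / real T) \<longlonglongrightarrow> c"
  shows "\<forall>i\<in>{1..p}.
      (AE \<omega> in M. (\<lambda>T. yule_walker p (biased_cov \<sigma>\<^sub>x \<sigma>\<^sub>w (N\<^sub>r T) T (obs T \<omega>)) i)
         \<longlonglongrightarrow> complex_of_real (a i)) \<and>
      (AE \<omega> in M. (\<lambda>T. yule_walker p (unbiased_cov \<sigma>\<^sub>x \<sigma>\<^sub>w (N\<^sub>r T) T (obs T \<omega>)) i)
         \<longlonglongrightarrow> complex_of_real (a i))"
proof -
  interpret prob_space M using model[of 1] by (simp add: ar_observation_model_def)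
  have \<sigma>: "\<sigma>\<^sub>x \<noteq> 0" using variances by simp
  have cov: "expectation (\<lambda>\<omega>. h T n t \<omega> * cnj (h T n (t - k) \<omega>)) = of_real (\<sigma>\<^sub>x\<^sup>2) * r k"
    if "1 \<le> T" "n < N\<^sub>r T" for T n t k
    using r[OF that, of k t] \<sigma> by simp
  have obs': "obs T \<omega> = (\<lambda>n t. h T n t \<omega> + w T n t \<omega>)" for T \<omega> by (simp add: fun_eq_iff obs)
  have ev_N: "\<forall>\<^sub>F T in sequentially. 1 \<le> T \<and> 0 < N\<^sub>r T"
    using order_tendstoD(1)[OF regime c_pos] eventually_ge_at_top[of 1]
    by eventually_elim (auto intro: gr0I)
  \<comment> \<open>Nonsingularity and the Yule-Walker equations concern \<open>r\<close> alone, but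
    \<open>r\<close> is tied to the model only through an existing row; a single
    \<open>T\<^sub>0\<close> with at least one row is enough.\<close>
  obtain T\<^sub>0 where T0: "1 \<le> T\<^sub>0" "0 < N\<^sub>r T\<^sub>0"
    using eventually_happens[OF ev_N] by auto
  interpret M0: ar_observation_model M p a \<sigma>\<^sub>x \<sigma>\<^sub>w "N\<^sub>r T\<^sub>0" T\<^sub>0 "h T\<^sub>0" "x T\<^sub>0" "w T\<^sub>0"
    by (rule model[OF T0(1)])
  have nonsing: "Determinant.det (toeplitz p r) \<noteq> 0"
    by (rule M0.toeplitz_nonsingular[OF T0(2) \<sigma> cov[OF T0]])
  have yw: "yule_walker p r i = complex_of_real (a i)" if "i \<in> {1..p}" for i
    by (rule yule_walker_eqI[OF nonsing _ that])
       (rule M0.yule_walker_equation[OF T0(2) \<sigma> cov[OF T0]], simp)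

  define row where "row k T = ar_observation_model.row_lag_mean T (h T) (w T) k" for k T
  \<comment> \<open>The limit is the covariance of the observations at lag \<open>k\<close>. In the
    moment bound, \<open>\<sigma>\<^sub>x\<^sup>2 * Re (r 0)\<close> is the variance of every
    \<open>h T n t\<close>, which makes \<open>B\<close> the same for all \<open>T\<close> and
    \<open>n\<close>.\<close>
  have rows: "AE \<omega> in M. (\<lambda>T. (\<Sum>n<N\<^sub>r T. row k T n \<omega>) / of_nat (N\<^sub>r T))
      \<longlonglongrightarrow> of_real (\<sigma>\<^sub>x\<^sup>2) * r k + (if k = 0 then of_real (\<sigma>\<^sub>w\<^sup>2) else 0)" (is "AE \<omega> in M. _ \<longlonglongrightarrow> ?\<mu>") for k
  proof (rule strong_law_triangular_array_complex[OF _ _ regime c_pos,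
      where m = "\<lambda>T. of_real ((real T - real_of_int \<bar>k\<bar>) / real T) *
        (of_real (\<sigma>\<^sub>x\<^sup>2) * r k + (if k = 0 then of_real (\<sigma>\<^sub>w\<^sup>2) else 0))"
      and B = "128 * (840 * (\<sigma>\<^sub>x\<^sup>2 * Re (r 0)) ^ 4 + 840 * \<sigma>\<^sub>w ^ 8)"])
    show "\<forall>\<^sub>F T in sequentially. indep_vars (\<lambda>_. borel) (row k T) {..<N\<^sub>r T}"
      using eventually_ge_at_top[of 1]
    proof eventually_elim
      case (elim T)
      interpret T: ar_observation_model M p a \<sigma>\<^sub>x \<sigma>\<^sub>w "N\<^sub>r T" T "h T" "x T" "w T"
        by (rule model[OF elim])
      show ?case unfolding row_def by (rule T.indep_row_lag_mean)
    qed
    show "\<forall>\<^sub>F T in sequentially. \<forall>n<N\<^sub>r T. integrable M (\<lambda>\<omega>. cmod (row k T n \<omega>) ^ 4) \<and>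
      expectation (\<lambda>\<omega>. cmod (row k T n \<omega>) ^ 4) \<le> 128 * (840 * (\<sigma>\<^sub>x\<^sup>2 * Re (r 0)) ^ 4 + 840 * \<sigma>\<^sub>w ^ 8) \<and>
      expectation (row k T n) = of_real ((real T - real_of_int \<bar>k\<bar>) / real T) *
        (of_real (\<sigma>\<^sub>x\<^sup>2) * r k + (if k = 0 then of_real (\<sigma>\<^sub>w\<^sup>2) else 0))"
      using eventually_ge_at_top[of 1] eventually_ge_at_top[of "nat \<bar>k\<bar>"]
    proof eventually_elim
      case (elim T)
      interpret T: ar_observation_model M p a \<sigma>\<^sub>x \<sigma>\<^sub>w "N\<^sub>r T" T "h T" "x T" "w T"
        by (rule model[OF elim(1)])
      show ?case
      proof (intro allI impI)
        fix n assume n: "n < N\<^sub>r T"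
        have "expectation (\<lambda>\<omega>. (cmod (h T n t \<omega>))\<^sup>2) = \<sigma>\<^sub>x\<^sup>2 * Re (r 0)" for t
        proof -
          have "complex_of_real (expectation (\<lambda>\<omega>. (cmod (h T n t \<omega>))\<^sup>2)) = of_real (\<sigma>\<^sub>x\<^sup>2) * r 0"
            using cov[OF elim(1) n, of t 0]
            by (simp only: integral_complex_of_real[symmetric] complex_norm_square diff_zero)
          then show ?thesis by (simp add: complex_eq_iff)
        qed
        note v = T.row_lag_mean_fourth_moment[OF n elim(1) this, of k]
        have "\<bar>k\<bar> \<le> int T" using elim(2) by linarith
        from T.expectation_row_lag_mean[OF n this cov[OF elim(1) n]] v
        show "integrable M (\<lambda>\<omega>. cmod (row k T n \<omega>) ^ 4) \<and>
          expectation (\<lambda>\<omega>. cmod (row k T n \<omega>) ^ 4) \<le> 128 * (840 * (\<sigma>\<^sub>x\<^sup>2 * Re (r 0)) ^ 4 + 840 * \<sigma>\<^sub>w ^ 8) \<and>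
          expectation (row k T n) = of_real ((real T - real_of_int \<bar>k\<bar>) / real T) *
            (of_real (\<sigma>\<^sub>x\<^sup>2) * r k + (if k = 0 then of_real (\<sigma>\<^sub>w\<^sup>2) else 0))"
          unfolding row_def by blast
      qed
    qed
    have "(\<lambda>T. (real T - real_of_int \<bar>k\<bar>) / real T) \<longlonglongrightarrow> 1" by real_asymp
    then have "(\<lambda>T. of_real ((real T - real_of_int \<bar>k\<bar>) / real T) * ?\<mu>) \<longlonglongrightarrow> of_real 1 * ?\<mu>"
      by (intro tendsto_mult tendsto_of_real tendsto_const)
    then show "(\<lambda>T. of_real ((real T - real_of_int \<bar>k\<bar>) / real T) * ?\<mu>) \<longlonglongrightarrow> ?\<mu>" by simp
  qed

  have biased: "AE \<omega> in M. (\<lambda>T. biased_cov \<sigma>\<^sub>x \<sigma>\<^sub>w (N\<^sub>r T) T (obs T \<omega>) k) \<longlonglongrightarrow> r k" for k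
    using rows[of k]
  proof eventually_elim
    case (elim \<omega>)
    have "(\<lambda>T. ((\<Sum>n<N\<^sub>r T. row k T n \<omega>) / of_nat (N\<^sub>r T) - (if k = 0 then of_real (\<sigma>\<^sub>w\<^sup>2) else 0)) / of_real (\<sigma>\<^sub>x\<^sup>2))
        \<longlonglongrightarrow> (of_real (\<sigma>\<^sub>x\<^sup>2) * r k + (if k = 0 then of_real (\<sigma>\<^sub>w\<^sup>2) else 0) -
          (if k = 0 then of_real (\<sigma>\<^sub>w\<^sup>2) else 0)) / of_real (\<sigma>\<^sub>x\<^sup>2)"
      using \<sigma> by (intro tendsto_divide tendsto_diff elim tendsto_const) simp
    then have lim: "(\<lambda>T. ((\<Sum>n<N\<^sub>r T. row k T n \<omega>) / of_nat (N\<^sub>r T) -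
        (if k = 0 then of_real (\<sigma>\<^sub>w\<^sup>2) else 0)) / of_real (\<sigma>\<^sub>x\<^sup>2)) \<longlonglongrightarrow> r k"
      using \<sigma> by simp
    show ?case
    proof (rule Lim_transform_eventually[OF lim])
      show "\<forall>\<^sub>F T in sequentially. ((\<Sum>n<N\<^sub>r T. row k T n \<omega>) / of_nat (N\<^sub>r T) -
          (if k = 0 then of_real (\<sigma>\<^sub>w\<^sup>2) else 0)) / of_real (\<sigma>\<^sub>x\<^sup>2) = biased_cov \<sigma>\<^sub>x \<sigma>\<^sub>w (N\<^sub>r T) T (obs T \<omega>) k"
        using eventually_ge_at_top[of 1]
      proof eventually_elim
        case (elim T)
        interpret T: ar_observation_model M p a \<sigma>\<^sub>x \<sigma>\<^sub>w "N\<^sub>r T" T "h T" "x T" "w T"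
          by (rule model[OF elim])
        show ?case
          unfolding biased_cov_eq[OF \<sigma>] obs' T.lag_product_sum_eq_row_lag_mean[OF elim] row_def ..
      qed
    qed
  qed

  \<comment> \<open>This is deterministic, for one sample point at a time, so the unbiased estimates
    converge wherever the biased ones do.\<close>
  have unbiased: "(\<lambda>T. unbiased_cov \<sigma>\<^sub>x \<sigma>\<^sub>w (N\<^sub>r T) T (obs T \<omega>) k) \<longlonglongrightarrow> r k"
    if b: "(\<lambda>T. biased_cov \<sigma>\<^sub>x \<sigma>\<^sub>w (N\<^sub>r T) T (obs T \<omega>) k) \<longlonglongrightarrow> r k" for k \<omega>
  proof -
    have "(\<lambda>T. real T / (real T - \<bar>real_of_int k\<bar>)) \<longlonglongrightarrow> 1" by real_asymp
    then have "(\<lambda>T. complex_of_real (real T / (real T - \<bar>real_of_int k\<bar>))) \<longlonglongrightarrow> of_real 1"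
      by (rule tendsto_of_real)
    then have "(\<lambda>T. if k = 0 then 1 else complex_of_real (real T / (real T - \<bar>real_of_int k\<bar>))) \<longlonglongrightarrow> 1"
      by (cases "k = 0") simp_all
    from tendsto_mult[OF this b]
    have "(\<lambda>T. (if k = 0 then 1 else complex_of_real (real T / (real T - \<bar>real_of_int k\<bar>))) *
        biased_cov \<sigma>\<^sub>x \<sigma>\<^sub>w (N\<^sub>r T) T (obs T \<omega>) k) \<longlonglongrightarrow> r k" by simp
    moreover have "\<forall>\<^sub>F T in sequentially. (if k = 0 then 1 else complex_of_real (real T / (real T - \<bar>real_of_int k\<bar>))) *
        biased_cov \<sigma>\<^sub>x \<sigma>\<^sub>w (N\<^sub>r T) T (obs T \<omega>) k = unbiased_cov \<sigma>\<^sub>x \<sigma>\<^sub>w (N\<^sub>r T) T (obs T \<omega>) k"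
      using eventually_gt_at_top[of "nat \<bar>k\<bar>"]
    proof eventually_elim
      case (elim T)
      then have "\<bar>k\<bar> < int T" by linarith
      from unbiased_cov_eq_biased_cov[OF this] show ?case by simp
    qed
    ultimately show ?thesis by (rule Lim_transform_eventually)
  qed

  \<comment> \<open>The lags are countable, so one null set serves all of them; outside it the
    continuity of the Yule-Walker solution applies pathwise.\<close>
  have "AE \<omega> in M. \<forall>k. (\<lambda>T. biased_cov \<sigma>\<^sub>x \<sigma>\<^sub>w (N\<^sub>r T) T (obs T \<omega>) k) \<longlonglongrightarrow> r k"
    using biased by (simp add: AE_all_countable)
  then have "(AE \<omega> in M. (\<lambda>T. yule_walker p (biased_cov \<sigma>\<^sub>x \<sigma>\<^sub>w (N\<^sub>r T) T (obs T \<omega>)) i) \<longlonglongrightarrow> yule_walker p r i) \<and>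
      (AE \<omega> in M. (\<lambda>T. yule_walker p (unbiased_cov \<sigma>\<^sub>x \<sigma>\<^sub>w (N\<^sub>r T) T (obs T \<omega>)) i) \<longlonglongrightarrow> yule_walker p r i)"
    if "i \<in> {1..p}" for i
    by (intro conjI; eventually_elim) (intro tendsto_yule_walker nonsing that; simp add: unbiased)+
  then show ?thesis using yw by simp
qed

end
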